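(* Let $\beta\in(1,\beta_* )$, where $\beta_*\approx1.4656$ is the real root of $x^3-x^2-1=0$. Then the measure $\nu_\beta$ on $\Omega\times\Upsilon\times S_\beta$ defined by $\nu_\beta(A)=\mathbb P(\varphi(Z\cap A))$ is the unique $K_\beta$-invariant probability measure of maximal entropy.
   Context: $\vec q_0=(0,0)$, $\vec q_1=(1,0)$, $\vec q_2=(0,1)$; $S_\beta$ is the attractor of the IFS $f_{\vec q_i}(\vec z)=(\vec z+\vec q_i)/\beta$ (here the closed triangle with vertices $(0,0)$, $(\frac1{\beta-1},0)$, $(0,\frac1{\beta-1})$), with Borel $\sigma$-algebra. Subsets of $S_\beta$: $E_0=[0,\frac1\beta)\times[0,\frac1\beta)$; $E_1=\{0\le y<\frac1\beta,\ \frac{1}{\beta(\beta-1)}<x+y\le\frac{1}{\beta-1}\}$; $E_2=\{0\le x<\frac1\beta,\ \frac{1}{\beta(\beta-1)}<x+y\le\frac{1}{\beta-1}\}$; $C_{01}=\{x\ge\frac1\beta,\ 0\le y<\frac1\beta,\ x+y\le\frac{1}{\beta(\beta-1)}\}$; $C_{12}=\{x\ge\frac1\beta,\ y\ge\frac1\beta,\ \frac{1}{\beta(\beta-1)}<x+y\le\frac{1}{\beta-1}\}$; $C_{02}=\{0\le x<\frac1\beta,\ y\ge\frac1\beta,\ x+y\le\frac{1}{\beta(\beta-1)}\}$; $C_{012}=\{x\ge\frac1\beta,\ y\ge\frac1\beta,\ x+y\le\frac{1}{\beta(\beta-1)}\}$; $C=C_{01}\cup C_{12}\cup C_{02}$.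 $\Omega=\{0,1\}^{\mathbb N}$, $\Upsilon=\{0,1,2\}^{\mathbb N}$ with product $\sigma$-algebras and left shifts $\sigma,\sigma'$; $\mathbb P$ is the uniform product measure on $\Upsilon$. $K_\beta$ on $\Omega\times\Upsilon\times S_\beta$: $K_\beta(\omega,\upsilon,\vec z)=(\omega,\upsilon,\beta\vec z-\vec q_i)$ if $\vec z\in E_i$; $(\sigma\omega,\upsilon,\beta\vec z-\vec q_i)$ if $\omega_1=0$, $\vec z\in C_{ij}$ ($ij\in\{01,12,02\}$); $(\sigma\omega,\upsilon,\beta\vec z-\vec q_j)$ if $\omega_1=1$, $\vec z\in C_{ij}$; $(\omega,\sigma'\upsilon,\beta\vec z-\vec q_i)$ if $\vec z\in C_{012}$, $\upsilon_1=i$. The digit $d_1$ is the vector subtracted, $d_n=d_1\circ K_\beta^{n-1}$; $\varphi(\omega,\upsilon,\vec z)=(b_1,b_2,\ldots)\in\Upsilon$ where $d_n(\omega,\upsilon,\vec z)=\vec q_{b_n}$. $Z$ is the set of points whose $K_\beta$-orbit visits $\Omega\times\Upsilon\times C$ infinitely often and $\Omega\times\Upsilon\times C_{012}$ infinitely often. *)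

theory Defs
  imports "HOL-Probability.Probability"
begin

definition beta_star :: real where
  "beta_star = (THE x::real. x ^ 3 - x ^ 2 - 1 = 0)"

definition q :: "nat \<Rightarrow> real \<times> real" where
  "q i = (if i = 1 then (1, 0) else if i = 2 then (0, 1) else (0, 0))"

definition Sb :: "real \<Rightarrow> (real \<times> real) set" where
  "Sb \<beta> = {(x, y). 0 \<le> x \<and> 0 \<le> y \<and> x + y \<le> 1 / (\<beta> - 1)}"

definition E0 :: "real \<Rightarrow> (real \<times> real) set" where
  "E0 \<beta> = Sb \<beta> \<inter> {(x, y). 0 \<le> x \<and> x < 1/\<beta> \<and> 0 \<le> y \<and> y < 1/\<beta>}"

definition E1 :: "real \<Rightarrow> (real \<times> real) set" where
  "E1 \<beta> = Sb \<beta> \<inter> {(x, y). 0 \<le> y \<and> y < 1/\<beta> \<and>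
      1/(\<beta>*(\<beta>-1)) < x + y \<and> x + y \<le> 1/(\<beta>-1)}"

definition E2 :: "real \<Rightarrow> (real \<times> real) set" where
  "E2 \<beta> = Sb \<beta> \<inter> {(x, y). 0 \<le> x \<and> x < 1/\<beta> \<and>
      1/(\<beta>*(\<beta>-1)) < x + y \<and> x + y \<le> 1/(\<beta>-1)}"

definition C01 :: "real \<Rightarrow> (real \<times> real) set" where
  "C01 \<beta> = Sb \<beta> \<inter> {(x, y). x \<ge> 1/\<beta> \<and> 0 \<le> y \<and> y < 1/\<beta> \<and> x + y \<le> 1/(\<beta>*(\<beta>-1))}"

definition C12 :: "real \<Rightarrow> (real \<times> real) set" where
  "C12 \<beta> = Sb \<beta> \<inter> {(x, y). x \<ge> 1/\<beta> \<and> y \<ge> 1/\<beta> \<and>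
      1/(\<beta>*(\<beta>-1)) < x + y \<and> x + y \<le> 1/(\<beta>-1)}"

definition C02 :: "real \<Rightarrow> (real \<times> real) set" where
  "C02 \<beta> = Sb \<beta> \<inter> {(x, y). 0 \<le> x \<and> x < 1/\<beta> \<and> y \<ge> 1/\<beta> \<and> x + y \<le> 1/(\<beta>*(\<beta>-1))}"

definition C012 :: "real \<Rightarrow> (real \<times> real) set" where
  "C012 \<beta> = Sb \<beta> \<inter> {(x, y). x \<ge> 1/\<beta> \<and> y \<ge> 1/\<beta> \<and> x + y \<le> 1/(\<beta>*(\<beta>-1))}"

definition Cset :: "real \<Rightarrow> (real \<times> real) set" where
  "Cset \<beta> = C01 \<beta> \<union> C12 \<beta> \<union> C02 \<beta>"

type_synonym state = "(nat \<Rightarrow> nat) \<times> (nat \<Rightarrow> nat) \<times> (real \<times> real)"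

text \<open>Omega = {0,1}^N, Upsilon = {0,1,2}^N (index 0 is the first coordinate).\<close>
definition Omega_M :: "(nat \<Rightarrow> nat) measure" where
  "Omega_M = PiM UNIV (\<lambda>_. count_space {0, 1})"

definition Ups_M :: "(nat \<Rightarrow> nat) measure" where
  "Ups_M = PiM UNIV (\<lambda>_. count_space {0, 1, 2})"

definition S_M :: "real \<Rightarrow> (real \<times> real) measure" where
  "S_M \<beta> = restrict_space borel (Sb \<beta>)"

definition Mb :: "real \<Rightarrow> state measure" where
  "Mb \<beta> = Omega_M \<Otimes>\<^sub>M (Ups_M \<Otimes>\<^sub>M S_M \<beta>)"

definition Pups :: "(nat \<Rightarrow> nat) measure" where
  "Pups = PiM UNIV (\<lambda>_. uniform_count_measure {0, 1, 2})"

definition sh :: "(nat \<Rightarrow> nat) \<Rightarrow> (nat \<Rightarrow> nat)" where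
  "sh w = (\<lambda>n. w (Suc n))"

definition Kd :: "real \<Rightarrow> state \<Rightarrow> state \<times> nat" where
  "Kd \<beta> p = (case p of (w, u, z) \<Rightarrow>
     if z \<in> E0 \<beta> then ((w, u, \<beta> *\<^sub>R z - q 0), 0)
     else if z \<in> E1 \<beta> then ((w, u, \<beta> *\<^sub>R z - q 1), 1)
     else if z \<in> E2 \<beta> then ((w, u, \<beta> *\<^sub>R z - q 2), 2)
     else if z \<in> C01 \<beta> then
       (if w 0 = 0 then ((sh w, u, \<beta> *\<^sub>R z - q 0), 0) else ((sh w, u, \<beta> *\<^sub>R z - q 1), 1))
     else if z \<in> C12 \<beta> then
       (if w 0 = 0 then ((sh w, u, \<beta> *\<^sub>R z - q 1), 1) else ((sh w, u, \<beta> *\<^sub>R z - q 2), 2))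
     else if z \<in> C02 \<beta> then
       (if w 0 = 0 then ((sh w, u, \<beta> *\<^sub>R z - q 0), 0) else ((sh w, u, \<beta> *\<^sub>R z - q 2), 2))
     else if z \<in> C012 \<beta> then ((w, sh u, \<beta> *\<^sub>R z - q (u 0)), u 0)
     else ((w, u, z), 0))"

definition Kb :: "real \<Rightarrow> state \<Rightarrow> state" where
  "Kb \<beta> p = fst (Kd \<beta> p)"

text \<open>index b of the first digit q_b\<close>
definition digit1 :: "real \<Rightarrow> state \<Rightarrow> nat" where
  "digit1 \<beta> p = snd (Kd \<beta> p)"

definition phib :: "real \<Rightarrow> state \<Rightarrow> (nat \<Rightarrow> nat)" where
  "phib \<beta> p = (\<lambda>n. digit1 \<beta> ((Kb \<beta> ^^ n) p))"

definition Zb :: "real \<Rightarrow> state set" where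
  "Zb \<beta> = {p \<in> space (Mb \<beta>).
      (\<exists>\<^sub>\<infinity>n. snd (snd ((Kb \<beta> ^^ n) p)) \<in> Cset \<beta>) \<and>
      (\<exists>\<^sub>\<infinity>n. snd (snd ((Kb \<beta> ^^ n) p)) \<in> C012 \<beta>)}"

definition nub :: "real \<Rightarrow> state measure" where
  "nub \<beta> = measure_of (space (Mb \<beta>)) (sets (Mb \<beta>))
             (\<lambda>A. emeasure Pups (phib \<beta> ` (Zb \<beta> \<inter> A)))"

definition invariant_prob :: "'a measure \<Rightarrow> ('a \<Rightarrow> 'a) \<Rightarrow> 'a measure \<Rightarrow> bool" where
  "invariant_prob M T \<mu> \<longleftrightarrow> sets \<mu> = sets M \<and> prob_space \<mu> \<and>
      T \<in> M \<rightarrow>\<^sub>M M \<and> distr \<mu> M T = \<mu>"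

definition fin_part :: "'a measure \<Rightarrow> 'a set set \<Rightarrow> bool" where
  "fin_part \<mu> \<alpha> \<longleftrightarrow> finite \<alpha> \<and> \<alpha> \<subseteq> sets \<mu> \<and> disjoint \<alpha> \<and> \<Union>\<alpha> = space \<mu>"

definition part_entropy :: "'a measure \<Rightarrow> 'a set set \<Rightarrow> real" where
  "part_entropy \<mu> \<alpha> =
     (\<Sum>A\<in>\<alpha>. if measure \<mu> A = 0 then 0 else - measure \<mu> A * ln (measure \<mu> A))"

definition join_part :: "('a \<Rightarrow> 'a) \<Rightarrow> 'a measure \<Rightarrow> 'a set set \<Rightarrow> nat \<Rightarrow> 'a set set" where
  "join_part T \<mu> \<alpha> n = {(\<Inter>i<n. (T ^^ i) -` g i) \<inter> space \<mu> | g. \<forall>i<n. g i \<in> \<alpha>}"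

definition ent_part :: "('a \<Rightarrow> 'a) \<Rightarrow> 'a measure \<Rightarrow> 'a set set \<Rightarrow> real" where
  "ent_part T \<mu> \<alpha> = lim (\<lambda>n. part_entropy \<mu> (join_part T \<mu> \<alpha> n) / real n)"

definition ks_entropy :: "('a \<Rightarrow> 'a) \<Rightarrow> 'a measure \<Rightarrow> ereal" where
  "ks_entropy T \<mu> = (SUP \<alpha>\<in>{\<alpha>. fin_part \<mu> \<alpha>}. ereal (ent_part T \<mu> \<alpha>))"

end

theory Submission
  imports Defs
begin

text \<open>
  The digit map \<open>phib\<close> semi-conjugates \<open>Kb\<close> to the shift on three symbols. Inverting it on \<open>Zb\<close> is
  explicit (the coin tosses are read off the digits at the visits to the switch regions), and a uniform
  random digit sequence visits both kinds of switch region infinitely often, because each of them has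
  interior points and hence contains the image of some cylinder. So a probability measure on the state
  space that projects to the Bernoulli measure is \<open>nub\<close>.

  For the entropy, an arbitrary invariant measure has to be compared with its image under \<open>phib\<close>, although
  \<open>phib\<close> is not injective off \<open>Zb\<close>. The point is that a state is determined by its image and its digit.
  Up to errors of small entropy, a finite partition depends on finitely many coordinates of the two coin
  sequences and of the digit sequence; those of the coin sequences along the first \<open>n\<close> steps can be
  recovered backwards from their values at time \<open>n\<close>, which cost a bounded amount of entropy. Hence the
  entropy of the system is that of the digit process: at most \<open>ln 3\<close>, with equality only if all digit
  words of length \<open>n\<close> have measure \<open>3\<^sup>-\<^sup>n\<close>.
\<close>

section \<open>Entropy of finite-valued functions\<close>

text \<open>All entropy estimates are made for finite-valued functions instead of partitions and
  rest on three facts: a function determined by another has no larger entropy, a pair has at most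
  the sum, and invariance makes time shifts free. The reason why image and digit determine a state:
  the digit \<open>d\<close> gives the old position \<open>(z + q d) / \<beta>\<close>, the position
  gives the switch region, and region and digit give the coin consumed. Recovery has to run
  backwards, since off \<open>Zb\<close> a coin may never be consumed and then no digit ever reveals
  it. A further obstacle is that the region depends on the position, hence on infinitely many later
  digits; at finite length it is only guessed from a digit word, and the guesses are corrected by a
  second error term besides the one for the partition. The constant 3/2 enters as
  \<open>1 / (\<beta> - 1) > 2\<close>: it puts the corner \<open>(1/\<beta>, 1/\<beta>)\<close>
  strictly below the line \<open>x + y = 1 / (\<beta> * (\<beta> - 1))\<close>, so that
  \<open>C012\<close> has interior points and \<open>E0\<close> is disjoint from \<open>E1\<close>
  and \<open>E2\<close>.\<close>

definition fun_entropy :: "'a measure \<Rightarrow> ('a \<Rightarrow> 'b) \<Rightarrow> real" where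
  "fun_entropy M X = (\<Sum>x\<in>X ` space M. - measure M (X -` {x} \<inter> space M) * ln (measure M (X -` {x} \<inter> space M)))"

text \<open>Values outside the range contribute \<open>0 * ln 0 = 0\<close>; this allows summation
  over a fixed set, such as all words of a given length.\<close>

lemma fun_entropy_superset:
  assumes "finite B" "X ` space M \<subseteq> B"
  shows "fun_entropy M X = (\<Sum>x\<in>B. - measure M (X -` {x} \<inter> space M) * ln (measure M (X -` {x} \<inter> space M)))"
  unfolding fun_entropy_def
proof (rule sum.mono_neutral_left[OF assms], rule ballI)
  fix i assume "i \<in> B - X ` space M"
  then have "X -` {i} \<inter> space M = {}" by auto
  then show "- measure M (X -` {i} \<inter> space M) * ln (measure M (X -` {i} \<inter> space M)) = 0"
    by simp
qed

context prob_space
begin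

lemma information_space_exp: "information_space M (exp 1)"
  by unfold_locales simp

lemma fun_entropy_eq_entropy:
  assumes X: "simple_function M X"
  shows "fun_entropy M X = entropy (exp 1) (count_space (X ` space M)) X"
proof -
  interpret information_space M "exp 1" by (rule information_space_exp)
  show ?thesis
    unfolding entropy_simple_distributed[OF simple_distributedI[OF X measure_nonneg refl]]
    by (simp add: fun_entropy_def log_def sum_negf)
qed

lemma fun_entropy_const: "fun_entropy M (\<lambda>p. c) = 0"
proof -
  have "(\<lambda>p. c) ` space M = {c}" using not_empty by auto
  then show ?thesis using prob_space by (simp add: fun_entropy_def)
qed

text \<open>Data processing in pointwise form: phrasing determination as an implication spares an
  explicit factor map, which the proof recovers by choice.\<close>

lemma fun_entropy_determined:
  assumes X: "simple_function M X"
    and det: "\<And>p p'. p \<in> space M \<Longrightarrow> p' \<in> space M \<Longrightarrow> X p = X p' \<Longrightarrow> Y p = Y p'"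
  shows "simple_function M Y" and "fun_entropy M Y \<le> fun_entropy M X"
proof -
  interpret information_space M "exp 1"
    by (rule information_space_exp)
  define f where "f x = Y (SOME p. p \<in> space M \<and> X p = x)" for x
  have Y: "f (X p) = Y p" if "p \<in> space M" for p
  proof -
    have "\<exists>p'. p' \<in> space M \<and> X p' = X p" using that by auto
    from someI_ex[OF this] show ?thesis unfolding f_def using det that by blast
  qed
  have fX: "simple_function M (f \<circ> X)" using X by (rule simple_function_compose)
  show SY: "simple_function M Y"
    using fX by (subst simple_function_cong[of M Y "f \<circ> X"]) (auto simp: Y)
  have "fun_entropy M Y = fun_entropy M (f \<circ> X)"
    unfolding fun_entropy_def
    by (intro sum.cong arg_cong[where f="\<lambda>A. - prob A * ln (prob A)"]) (auto simp: Y image_iff)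
  also have "\<dots> \<le> fun_entropy M X"
    unfolding fun_entropy_eq_entropy[OF X] fun_entropy_eq_entropy[OF fX]
    by (rule entropy_data_processing[OF X])
  finally show "fun_entropy M Y \<le> fun_entropy M X" .
qed

lemma fun_entropy_Pair:
  assumes X: "simple_function M X" and Y: "simple_function M Y"
  shows "fun_entropy M (\<lambda>p. (X p, Y p)) \<le> fun_entropy M X + fun_entropy M Y"
proof -
  interpret information_space M "exp 1"
    by (rule information_space_exp)
  show ?thesis
    unfolding fun_entropy_eq_entropy[OF X] fun_entropy_eq_entropy[OF Y]
      fun_entropy_eq_entropy[OF simple_function_Pair[OF X Y]]
      entropy_chain_rule[OF X Y]
    using conditional_entropy_less_eq_entropy[OF Y X] by simp
qed

lemma fun_entropy_nonneg: "0 \<le> fun_entropy M X"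
proof -
  have "t * ln t \<le> 0" if "0 \<le> t" "t \<le> 1" for t :: real
    using that by (cases "t = 0") (auto simp: mult_le_0_iff)
  then show ?thesis
    unfolding fun_entropy_def by (intro sum_nonneg) simp
qed

lemma simple_function_mem:
  assumes "A \<in> sets M"
  shows "simple_function M (\<lambda>p. p \<in> A)"
proof -
  have "(\<lambda>p. p \<in> A) -` {b} \<inter> space M = (if b then A else space M - A)" for b
    using sets.sets_into_space[OF assms] by auto
  then show ?thesis
    using assms unfolding simple_function_def by (auto intro: finite_subset[of _ UNIV])
qed

lemma simple_function_invariant:
  assumes T: "T \<in> M \<rightarrow>\<^sub>M M" and X: "simple_function M X"
  shows "simple_function M (\<lambda>p. X (T p))"
proof -
  have "(\<lambda>p. X (T p)) ` space M \<subseteq> X ` space M"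
    using measurable_space[OF T] by auto
  then have "finite ((\<lambda>p. X (T p)) ` space M)"
    using X finite_subset by (auto simp: simple_function_def)
  moreover have "(\<lambda>p. X (T p)) \<in> M \<rightarrow>\<^sub>M count_space UNIV"
    using measurable_compose[OF T measurable_simple_function[OF X]] by simp
  ultimately show ?thesis
    unfolding simple_function_def by (auto intro: measurable_sets)
qed

lemma fun_entropy_invariant:
  assumes T: "T \<in> M \<rightarrow>\<^sub>M M" "distr M M T = M" and X: "simple_function M X"
  shows "fun_entropy M (\<lambda>p. X (T p)) = fun_entropy M X"
proof -
  have sub: "(\<lambda>p. X (T p)) ` space M \<subseteq> X ` space M"
    using measurable_space[OF T(1)] by auto
  have fin: "finite (X ` space M)" using X by (simp add: simple_function_def)
  have "prob ((\<lambda>p. X (T p)) -` {x} \<inter> space M) = prob (X -` {x} \<inter> space M)"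
    if "x \<in> X ` space M" for x
  proof -
    have "X -` {x} \<inter> space M \<in> sets M" using X that by (auto simp: simple_function_def)
    then have "measure (distr M M T) (X -` {x} \<inter> space M) = prob (T -` (X -` {x} \<inter> space M) \<inter> space M)"
      by (rule measure_distr[OF T(1)])
    moreover have "T -` (X -` {x} \<inter> space M) \<inter> space M = (\<lambda>p. X (T p)) -` {x} \<inter> space M"
      using measurable_space[OF T(1)] by auto
    ultimately show ?thesis unfolding T(2) by simp
  qed
  then show ?thesis
    by (subst fun_entropy_superset[OF fin sub], unfold fun_entropy_def, intro sum.cong) auto
qed

text \<open>Finitely many predicates are packed into one value, the set of those that hold. This
  serves both for the atom containing a point and for the set of approximation errors.\<close>

lemma fun_entropy_set_le_sum:
  assumes "finite F" and "\<And>A. A \<in> F \<Longrightarrow> simple_function M (P A)"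
  shows "simple_function M (\<lambda>p. {A \<in> F. P A p}) \<and>
    fun_entropy M (\<lambda>p. {A \<in> F. P A p}) \<le> (\<Sum>A\<in>F. fun_entropy M (P A))"
  using assms
proof (induction F rule: finite_induct)
  case empty
  show ?case by (simp add: fun_entropy_const)
next
  case (insert B F)
  let ?X = "\<lambda>p. {A \<in> F. P A p}"
  have sX: "simple_function M ?X" and le: "fun_entropy M ?X \<le> (\<Sum>A\<in>F. fun_entropy M (P A))"
    using insert by auto
  have sP: "simple_function M (P B)" using insert by auto
  have det: "{A \<in> insert B F. P A p} = {A \<in> insert B F. P A p'}"
    if "(P B p, ?X p) = (P B p', ?X p')" for p p' using that by auto
  note D = fun_entropy_determined[OF simple_function_Pair[OF sP sX], of "\<lambda>p. {A \<in> insert B F. P A p}", OF det]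
  have "fun_entropy M (\<lambda>p. {A \<in> insert B F. P A p}) \<le> fun_entropy M (P B) + fun_entropy M ?X"
    using D(2) fun_entropy_Pair[OF sP sX] by auto
  then show ?case using D(1) le insert by auto
qed

end

section \<open>Itineraries and entropy rate of a measure-preserving map\<close>

definition word :: "('a \<Rightarrow> 'a) \<Rightarrow> ('a \<Rightarrow> 'b) \<Rightarrow> nat \<Rightarrow> 'a \<Rightarrow> 'b list" where
  "word T X n p = map (\<lambda>i. X ((T ^^ i) p)) [0..<n]"

lemma word_eq_iff:
  "word T X n p = word T X n p' \<longleftrightarrow> (\<forall>i<n. X ((T ^^ i) p) = X ((T ^^ i) p'))"
  by (auto simp: word_def)

lemma word_eq_map: "word T X n p = map f [0..<n] \<longleftrightarrow> (\<forall>i<n. X ((T ^^ i) p) = f i)"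
  by (auto simp: word_def)

locale measure_preserving = prob_space M for M :: "'a measure" +
  fixes T :: "'a \<Rightarrow> 'a"
  assumes T_meas: "T \<in> M \<rightarrow>\<^sub>M M" and T_inv: "distr M M T = M"
begin

lemma funpow_meas: "T ^^ n \<in> M \<rightarrow>\<^sub>M M"
  by (rule measurable_compose_n[OF T_meas])

lemma funpow_space: "p \<in> space M \<Longrightarrow> (T ^^ n) p \<in> space M"
  using measurable_space[OF funpow_meas] .

lemma funpow_distr: "distr M M (T ^^ n) = M"
proof (induction n)
  case 0 show ?case by (simp add: distr_id2 id_def)
next
  case (Suc n)
  have "distr M M (T ^^ Suc n) = distr (distr M M (T ^^ n)) M T"
    using distr_distr[OF T_meas funpow_meas, of n] by simp
  then show ?case using Suc T_inv by (simp add: comp_def)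
qed

text \<open>The block from time \<open>n\<close> to \<open>n + m\<close> is the word of length
  \<open>m\<close> at \<open>(T ^^ n) p\<close>, and by invariance it has the same entropy as the
  word at \<open>p\<close>.\<close>

lemma word_add:
  assumes X: "simple_function M X"
  shows "simple_function M (word T X n)"
    and "fun_entropy M (word T X (n + m)) \<le> fun_entropy M (word T X n) + fun_entropy M (word T X m)"
    and "fun_entropy M (word T X n) \<le> n * fun_entropy M X"
proof -
  have step: "simple_function M (word T X (n + m)) \<and>
     fun_entropy M (word T X (n + m)) \<le> fun_entropy M (word T X n) + fun_entropy M (word T X m)"
    if sn: "simple_function M (word T X n)" and sm: "simple_function M (word T X m)" for n m
  proof -
    let ?Y = "\<lambda>p. word T X m ((T ^^ n) p)"
    have sY: "simple_function M ?Y"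
      by (rule simple_function_invariant[OF funpow_meas sm])
    have det: "word T X (n + m) p = word T X (n + m) p'"
      if "(word T X n p, ?Y p) = (word T X n p', ?Y p')" for p p'
      unfolding word_eq_iff
    proof (intro allI impI)
      fix i assume i: "i < n + m"
      have a: "\<forall>i<n. X ((T ^^ i) p) = X ((T ^^ i) p')"
        and b: "\<forall>i<m. X ((T ^^ i) ((T ^^ n) p)) = X ((T ^^ i) ((T ^^ n) p'))"
        using that by (auto simp: word_eq_iff)
      show "X ((T ^^ i) p) = X ((T ^^ i) p')"
      proof (cases "i < n")
        case False
        have "(T ^^ i) p = (T ^^ (i - n)) ((T ^^ n) p)" for p
          using False by (metis comp_apply funpow_add le_add_diff_inverse2 not_less)
        then show ?thesis using b i False by auto
      qed (use a in auto)
    qed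
    note D = fun_entropy_determined[OF simple_function_Pair[OF sn sY], of "word T X (n + m)", OF det]
    show ?thesis
      using D fun_entropy_Pair[OF sn sY] fun_entropy_invariant[OF funpow_meas funpow_distr sm, of n] by force
  qed
  have one: "simple_function M (word T X 1)" "fun_entropy M (word T X 1) \<le> fun_entropy M X"
    by (rule fun_entropy_determined[OF X]; simp add: word_def)+
  have zero: "simple_function M (word T X 0)" "fun_entropy M (word T X 0) = 0"
    by (simp_all add: word_def[abs_def] fun_entropy_const)
  have sf: "simple_function M (word T X n)" for n
    by (induction n) (use zero one step[OF _ one(1)] in auto)
  show "simple_function M (word T X n)" by (rule sf)
  show "fun_entropy M (word T X (n + m)) \<le> fun_entropy M (word T X n) + fun_entropy M (word T X m)"
    using step sf by blast
  show "fun_entropy M (word T X n) \<le> n * fun_entropy M X"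
  proof (induction n)
    case (Suc n)
    then show ?case using step[OF sf sf, of n 1] one by (auto simp: algebra_simps)
  qed (use zero in auto)
qed

end

text \<open>Fekete's lemma; nonnegativity keeps the infimum bounded below.\<close>

lemma subadditive_tendsto_INF:
  fixes a :: "nat \<Rightarrow> real"
  assumes sub: "\<And>m n. a (m + n) \<le> a m + a n" and nn: "\<And>n. 0 \<le> a n"
  shows "(\<lambda>n. a n / n) \<longlonglongrightarrow> (INF n\<in>{1..}. a n / n)"
proof -
  define l where "l = (INF n\<in>{1..}. a n / n)"
  have bdd: "bdd_below ((\<lambda>n. a n / real n) ` {1..})"
    by (rule bdd_belowI[of _ 0]) (auto simp: nn)
  have low: "l \<le> a n / n" if "n \<ge> 1" for n
    unfolding l_def using that by (intro cINF_lower[OF bdd]) auto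
  have mult: "a (k * N + r) \<le> k * a N + a r" for k N r
  proof (induction k)
    case (Suc k)
    have "a (Suc k * N + r) \<le> a N + a (k * N + r)"
      using sub[of N "k * N + r"] by (simp add: add.assoc)
    then show ?case using Suc by (simp add: algebra_simps)
  qed simp
  have "(\<lambda>n. a n / n) \<longlonglongrightarrow> l"
  proof (rule LIMSEQ_I)
    fix e :: real assume e: "0 < e"
    have "l < l + e/2" using e by simp
    then obtain N where N: "N \<ge> 1" "a N / N < l + e/2"
      using cInf_lessD[of "(\<lambda>n. a n / real n) ` {1..}" "l + e/2"] unfolding l_def by auto
    \<comment> \<open>\<open>C\<close> bounds \<open>a\<close> at every remainder
      \<open>n mod N\<close>; by nonnegativity a sum can serve in place of a maximum.\<close>
    define C where "C = (\<Sum>r<N. a r)"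
    have C: "a r \<le> C" if "r < N" for r
      unfolding C_def using that by (intro member_le_sum) (auto simp: nn)
    obtain n0 :: nat where n0: "n0 > 2 * C / e" using reals_Archimedean2 by blast
    show "\<exists>no. \<forall>n\<ge>no. norm (a n / real n - l) < e"
    proof (intro exI allI impI)
      fix n assume n: "max n0 1 \<le> n"
      have "a n \<le> (n div N) * a N + a (n mod N)"
        using mult[of "n div N" N "n mod N"] by simp
      also have "a (n mod N) \<le> C" using C N by simp
      also have "(n div N) * a N = real (n div N * N) * (a N / N)" using N by simp
      also have "\<dots> \<le> real n * (a N / N)"
        by (intro mult_right_mono of_nat_mono) (simp_all add: nn)
      finally have "a n / n \<le> a N / N + C / n" using n by (simp add: field_simps)
      moreover have "2 * (C / n) < e"
      proof -
        have "2 * C / e < n" using n0 n by linarith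
        then show ?thesis using e n by (simp add: field_simps)
      qed
      ultimately show "norm (a n / real n - l) < e" using low[of n] n N by (simp add: abs_less_iff)
    qed
  qed
  then show ?thesis by (simp add: l_def)
qed

context measure_preserving
begin

text \<open>Taken as the infimum rather than the limit, so that it bounds the normalised word
  entropy at each fixed length. This turns a maximal rate into a statement about every word
  length.\<close>

definition entropy_rate :: "('a \<Rightarrow> 'b) \<Rightarrow> real" where
  "entropy_rate X = (INF n\<in>{1..}. fun_entropy M (word T X n) / n)"

lemma entropy_rate_lim:
  assumes "simple_function M X"
  shows "(\<lambda>n. fun_entropy M (word T X n) / n) \<longlonglongrightarrow> entropy_rate X"
  unfolding entropy_rate_def by (rule subadditive_tendsto_INF) (use word_add(2)[OF assms] fun_entropy_nonneg in auto)

lemma entropy_rate_le: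
  assumes "n \<ge> 1"
  shows "entropy_rate X \<le> fun_entropy M (word T X n) / n"
  unfolding entropy_rate_def using assms
  by (intro cINF_lower bdd_belowI[of _ 0]) (auto simp: fun_entropy_nonneg)

text \<open>On the space, \<open>X p\<close> is the singleton of the atom containing
  \<open>p\<close>, so the nonempty atoms of the joint partition are the level sets of the itinerary
  under \<open>X\<close>.\<close>

lemma ent_part_eq_rate:
  assumes \<alpha>: "fin_part M \<alpha>"
  defines "X \<equiv> \<lambda>p. {A \<in> \<alpha>. p \<in> A}"
  shows "simple_function M X" and "ent_part T M \<alpha> = entropy_rate X"
proof -
  have fin: "finite \<alpha>" and sub: "\<alpha> \<subseteq> sets M" and dis: "disjoint \<alpha>" and un: "\<Union>\<alpha> = space M"
    using \<alpha> by (auto simp: fin_part_def)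
  have "simple_function M (\<lambda>p. p \<in> A)" if "A \<in> \<alpha>" for A
    using that sub by (intro simple_function_mem) auto
  from fun_entropy_set_le_sum[OF fin this]
  show sX: "simple_function M X" unfolding X_def by simp
  have X: "X p = {A}" if "p \<in> A" "A \<in> \<alpha>" for p A
    using that dis unfolding X_def disjoint_def by fastforce
  have atom: "\<exists>A\<in>\<alpha>. p \<in> A" if "p \<in> space M" for p using that un by auto
  have pe: "part_entropy M (join_part T M \<alpha> n) = fun_entropy M (word T X n)" for n
  proof -
    let ?J = "join_part T M \<alpha> n" and ?W = "word T X n"
    let ?c = "\<lambda>y. ?W -` {y} \<inter> space M"
    have ifin: "finite (?W ` space M)" using word_add(1)[OF sX] by (simp add: simple_function_def)
    have lev: "(\<Inter>i<n. (T ^^ i) -` g i) \<inter> space M = ?c (map (\<lambda>i. {g i}) [0..<n])"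
      if g: "\<forall>i<n. g i \<in> \<alpha>" for g
    proof -
      have "(T ^^ i) p \<in> g i \<longleftrightarrow> X ((T ^^ i) p) = {g i}" if "i < n" for i p
      proof
        assume "X ((T ^^ i) p) = {g i}"
        then have "g i \<in> X ((T ^^ i) p)" by simp
        then show "(T ^^ i) p \<in> g i" by (simp add: X_def)
      qed (rule X, use g that in auto)
      then show ?thesis by (auto simp: word_eq_map)
    qed
    \<comment> \<open>A choice \<open>g\<close> that no orbit follows gives the empty atom, which
      belongs to no word; it contributes 0 to the sum.\<close>
    have J1: "?J \<subseteq> insert {} (?c ` (?W ` space M))"
    proof
      fix B assume "B \<in> ?J"
      then obtain g where g: "\<forall>i<n. g i \<in> \<alpha>" and "B = (\<Inter>i<n. (T ^^ i) -` g i) \<inter> space M"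
        unfolding join_part_def by blast
      then have B: "B = ?c (map (\<lambda>i. {g i}) [0..<n])" by (simp only: lev)
      show "B \<in> insert {} (?c ` (?W ` space M))"
      proof (cases "B = {}")
        case False
        then obtain p where "p \<in> B" by blast
        then have "p \<in> space M" "map (\<lambda>i. {g i}) [0..<n] = ?W p" unfolding B by simp_all
        then show ?thesis unfolding B by blast
      qed simp
    qed
    have J2: "?c ` (?W ` space M) \<subseteq> ?J"
    proof safe
      fix p assume p: "p \<in> space M"
      have "\<forall>i. \<exists>A. A \<in> \<alpha> \<and> (T ^^ i) p \<in> A" using atom[OF funpow_space[OF p]] by blast
      then obtain g where g: "\<And>i. g i \<in> \<alpha>" "\<And>i. (T ^^ i) p \<in> g i" by metis
      have "?W p = map (\<lambda>i. {g i}) [0..<n]" using X[OF g(2,1)] by (simp add: word_eq_map)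
      then have "?c (?W p) = (\<Inter>i<n. (T ^^ i) -` g i) \<inter> space M"
        using lev[of g] g(1) by simp
      moreover have "(\<Inter>i<n. (T ^^ i) -` g i) \<inter> space M \<in> ?J"
        unfolding join_part_def using g by blast
      ultimately show "?c (?W p) \<in> ?J" by (simp only:)
    qed
    have finJ: "finite ?J" using J1 ifin by (meson finite_subset finite_imageI finite_insert)
    have "part_entropy M ?J = (\<Sum>A\<in>?J. - measure M A * ln (measure M A))"
      unfolding part_entropy_def by (intro sum.cong) auto
    also have "\<dots> = (\<Sum>A\<in>?c ` (?W ` space M). - measure M A * ln (measure M A))"
      by (rule sum.mono_neutral_right[OF finJ J2]) (use J1 in auto)
    also have "\<dots> = fun_entropy M ?W"
      unfolding fun_entropy_def
    proof (rule sum.reindex_cong[where l = ?c])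
      show "inj_on ?c (?W ` space M)"
      proof (rule inj_onI)
        fix y y' assume "y \<in> ?W ` space M" and eq: "?c y = ?c y'"
        then obtain p where "p \<in> ?c y" by auto
        then have "p \<in> ?c y" "p \<in> ?c y'" using eq by blast+
        then show "y = y'" by simp
      qed
    qed auto
    finally show ?thesis .
  qed
  show "ent_part T M \<alpha> = entropy_rate X"
    unfolding ent_part_def pe by (rule limI[OF entropy_rate_lim[OF sX]])
qed

end

section \<open>Entropy of small events, maximal entropy, approximation by cylinders\<close>

context prob_space
begin

text \<open>Makes the entropy of an event tend to 0 with its probability \<open>t\<close>. The term
  of the event is at most \<open>2 * sqrt t\<close>, that of the complement at most
  \<open>t \<le> sqrt t\<close>; hence the factor 3.\<close>

lemma fun_entropy_bool_le_sqrt: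
  assumes "{p \<in> space M. P p} \<in> sets M"
  shows "simple_function M P" and "fun_entropy M P \<le> 3 * sqrt (prob {p \<in> space M. P p})"
proof -
  let ?t = "prob {p \<in> space M. P p}"
  have pre: "P -` {True} \<inter> space M = {p \<in> space M. P p}"
    "P -` {False} \<inter> space M = space M - {p \<in> space M. P p}" by auto
  show "simple_function M P"
    using simple_function_mem[OF assms] by (rule simple_function_cong[THEN iffD1, rotated]) simp
  have t: "0 \<le> ?t" "?t \<le> 1" by auto
  have "fun_entropy M P = (\<Sum>x\<in>UNIV. - prob (P -` {x} \<inter> space M) * ln (prob (P -` {x} \<inter> space M)))"
    by (rule fun_entropy_superset) auto
  also have "\<dots> = - ?t * ln ?t - (1 - ?t) * ln (1 - ?t)"
    unfolding UNIV_bool using pre prob_compl[OF assms] by simp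
  finally have "fun_entropy M P = - ?t * ln ?t - (1 - ?t) * ln (1 - ?t)" .
  moreover have "- ?t * ln ?t \<le> 2 * sqrt ?t"
  proof (cases "?t = 0")
    case False
    then have pos: "0 < ?t" using t by linarith
    \<comment> \<open>The bound \<open>ln x \<le> x - 1\<close> is applied at
      \<open>1 / sqrt t\<close> instead of \<open>1 / t\<close>; this produces the square
      root.\<close>
    have "ln (1 / sqrt ?t) \<le> 1 / sqrt ?t - 1" using pos by (intro ln_le_minus_one) simp
    then have "- ln ?t \<le> 2 / sqrt ?t" using pos by (simp add: ln_div ln_sqrt)
    then have "?t * (- ln ?t) \<le> ?t * (2 / sqrt ?t)" using t by (intro mult_left_mono)
    also have "?t * (2 / sqrt ?t) = 2 * (?t / sqrt ?t)" by (simp only: times_divide_eq_right mult.commute)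
    also have "\<dots> = 2 * sqrt ?t" using pos by (simp only: real_div_sqrt less_imp_le)
    finally show ?thesis by simp
  qed simp
  moreover have "- ((1 - ?t) * ln (1 - ?t)) \<le> ?t"
  proof (cases "?t = 1")
    case False
    then have pos: "0 < 1 - ?t" using t by linarith
    have "ln (1 / (1 - ?t)) \<le> 1 / (1 - ?t) - 1" using pos by (intro ln_le_minus_one) simp
    then have "(1 - ?t) * (- ln (1 - ?t)) \<le> (1 - ?t) * (1 / (1 - ?t) - 1)"
      using pos by (intro mult_left_mono) (simp_all add: ln_div)
    also have "\<dots> = ?t" using pos by (simp add: right_diff_distrib)
    finally show ?thesis by simp
  qed simp
  moreover have "?t \<le> sqrt ?t" using t by (intro real_le_rsqrt) (simp add: power2_eq_square mult_le_one mult_left_le)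
  ultimately show "fun_entropy M P \<le> 3 * sqrt ?t" by linarith
qed

text \<open>Gibbs' inequality term by term: \<open>- p * ln p \<le> p * ln N + (1 / N - p)\<close>,
  with equality only for \<open>p = 1 / N\<close>. The right-hand sides sum to \<open>ln N\<close>,
  so equality of the sums forces equality in each term.\<close>

lemma fun_entropy_le_ln_card:
  assumes X: "simple_function M X" and B: "finite B" "X ` space M \<subseteq> B"
  shows "fun_entropy M X \<le> ln (card B)"
    and "fun_entropy M X = ln (card B) \<Longrightarrow> x \<in> B \<Longrightarrow> prob (X -` {x} \<inter> space M) = 1 / card B"
proof -
  define N where "N = real (card B)"
  let ?p = "\<lambda>x. prob (X -` {x} \<inter> space M)"
  have "B \<noteq> {}" using B not_empty by auto
  then have N: "0 < N" using B(1) by (simp add: N_def card_gt_0_iff)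
  have sets: "X -` {x} \<inter> space M \<in> sets M" for x
  proof (cases "x \<in> X ` space M")
    case False
    then have "X -` {x} \<inter> space M = {}" by auto
    then show ?thesis by simp
  qed (use X in \<open>auto simp: simple_function_def\<close>)
  have "prob (\<Union>x\<in>B. X -` {x} \<inter> space M) = (\<Sum>x\<in>B. ?p x)"
    using sets B(1) by (intro finite_measure_finite_Union) (auto simp: disjoint_family_on_def)
  moreover have "(\<Union>x\<in>B. X -` {x} \<inter> space M) = space M" using B(2) by auto
  ultimately have sum1: "(\<Sum>x\<in>B. ?p x) = 1" using prob_space by simp
  have key: "- p * ln p \<le> p * ln N + (1 / N - p) \<and> (- p * ln p = p * ln N + (1 / N - p) \<longrightarrow> p = 1 / N)"
    if "0 \<le> p" for p :: real
  proof (cases "p = 0")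
    case False
    then have p: "0 < p" using that by simp
    have a: "p * ln (1 / (N * p)) = - p * ln p - p * ln N"
      using p N by (simp add: ln_div ln_mult algebra_simps)
    have b: "p * (1 / (N * p) - 1) = 1 / N - p" using p N by (simp add: field_simps)
    have "ln (1 / (N * p)) \<le> 1 / (N * p) - 1" using p N by (intro ln_le_minus_one) simp
    then have "p * ln (1 / (N * p)) \<le> p * (1 / (N * p) - 1)" using p by (intro mult_left_mono) simp_all
    moreover have "p = 1 / N" if "- p * ln p = p * ln N + (1 / N - p)"
    proof -
      have "p * ln (1 / (N * p)) = p * (1 / (N * p) - 1)" using that a b by simp
      then have "ln (1 / (N * p)) = 1 / (N * p) - 1" using p by simp
      then have "1 / (N * p) = 1" using p N by (intro ln_eq_minus_one) simp_all
      then show ?thesis using p N by (simp add: field_simps)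
    qed
    ultimately show ?thesis unfolding a b by linarith
  qed (use N in simp)
  have fe: "fun_entropy M X = (\<Sum>x\<in>B. - ?p x * ln (?p x))" by (rule fun_entropy_superset[OF B])
  have tot: "(\<Sum>x\<in>B. ?p x * ln N + (1 / N - ?p x)) = ln N"
    using sum1 N by (simp add: sum.distrib sum_subtractf sum_distrib_right[symmetric] N_def)
  have le: "- ?p x * ln (?p x) \<le> ?p x * ln N + (1 / N - ?p x)" for x
    using key[of "?p x"] by simp
  show "fun_entropy M X \<le> ln (card B)"
  proof -
    have "fun_entropy M X \<le> (\<Sum>x\<in>B. ?p x * ln N + (1 / N - ?p x))" unfolding fe by (intro sum_mono le)
    then show ?thesis unfolding tot by (simp only: N_def)
  qed
  assume eq: "fun_entropy M X = ln (card B)" and x: "x \<in> B"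
  have "(\<Sum>x\<in>B. (?p x * ln N + (1 / N - ?p x)) - (- ?p x * ln (?p x))) = 0"
    unfolding sum_subtractf[of _ "\<lambda>x. - ?p x * ln (?p x)"] tot using eq fe by (simp add: N_def)
  then have "(?p x * ln N + (1 / N - ?p x)) - (- ?p x * ln (?p x)) = 0"
    using sum_nonneg_eq_0_iff[OF B(1), of "\<lambda>x. (?p x * ln N + (1 / N - ?p x)) - (- ?p x * ln (?p x))"] le x
    by (metis (no_types, lifting) diff_ge_0_iff_ge)
  then have "- ?p x * ln (?p x) = ?p x * ln N + (1 / N - ?p x)" by linarith
  then show "?p x = 1 / card B" using key[of "?p x"] by (simp add: N_def)
qed

lemma sets_differ:
  assumes "A \<in> sets M" "{p \<in> space M. P p} \<in> sets M"
  shows "{p \<in> space M. (p \<in> A) \<noteq> P p} \<in> sets M"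
proof -
  have "{p \<in> space M. (p \<in> A) \<noteq> P p} = (A - {p \<in> space M. P p}) \<union> ({p \<in> space M. P p} - A)"
    using sets.sets_into_space[OF assms(1)] by auto
  also have "\<dots> \<in> sets M" by (intro sets.Un sets.Diff assms)
  finally show ?thesis .
qed

lemma cylinder_approx:
  fixes c :: "nat \<Rightarrow> 'a \<Rightarrow> 'b"
  defines "Gen \<equiv> {c n -` {x} \<inter> space M | n x. True}"
  assumes gens: "Gen \<subseteq> sets M" and A: "A \<in> sigma_sets (space M) Gen" and e: "0 < e"
  shows "\<exists>L0. \<forall>L\<ge>L0. \<exists>G. {p \<in> space M. (p \<in> A) \<noteq> G (map (\<lambda>i. c i p) [0..<L])} \<in> sets M
    \<and> prob {p \<in> space M. (p \<in> A) \<noteq> G (map (\<lambda>i. c i p) [0..<L])} < e"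
proof -
  let ?w = "\<lambda>L p. map (\<lambda>i. c i p) [0..<L]"
  have sub: "sigma_sets (space M) Gen \<subseteq> sets M" using gens by (rule sets.sigma_sets_subset)
  have tk: "take L (?w L' p) = ?w L p" if "L \<le> L'" for L L' p
    using that by (simp add: take_map)
  \<comment> \<open>The values of \<open>c\<close> need not be countable, so measurability of the
    approximating predicate is not automatic and is carried through the induction.\<close>
  have "\<exists>L G. {p \<in> space M. G (?w L p)} \<in> sets M \<and> prob {p \<in> space M. (p \<in> A) \<noteq> G (?w L p)} < e"
    using A e
  proof (induction arbitrary: e rule: sigma_sets.induct)
    case (Basic a)
    then obtain n x where a: "a = c n -` {x} \<inter> space M" by (auto simp: Gen_def)
    let ?G = "\<lambda>v. v ! n = x"
    have nth: "?w (Suc n) p ! n = c n p" for p by (simp del: upt_Suc)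
    have "{p \<in> space M. ?G (?w (Suc n) p)} = a" unfolding nth a by auto
    moreover have "{p \<in> space M. (p \<in> a) \<noteq> ?G (?w (Suc n) p)} = {}" unfolding nth a by auto
    moreover have "a \<in> sets M" using Basic gens by blast
    ultimately show ?case
      using Basic.prems by (intro exI[of _ "Suc n"] exI[of _ ?G]) (simp only: measure_empty simp_thms)
  next
    case Empty
    show ?case by (rule exI[of _ 0], rule exI[of _ "\<lambda>_. False"]) (use Empty in simp)
  next
    case (Compl a)
    obtain L G where G: "{p \<in> space M. G (?w L p)} \<in> sets M" "prob {p \<in> space M. (p \<in> a) \<noteq> G (?w L p)} < e"
      using Compl by blast
    have "{p \<in> space M. \<not> G (?w L p)} = space M - {p \<in> space M. G (?w L p)}" by blast
    moreover have "{p \<in> space M. (p \<in> space M - a) \<noteq> (\<not> G (?w L p))} = {p \<in> space M. (p \<in> a) \<noteq> G (?w L p)}" by blast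
    ultimately show ?case using G by (intro exI[of _ L] exI[of _ "\<lambda>v. \<not> G v"]) simp
  next
    case (Union a)
    have a: "a i \<in> sets M" for i using Union(1) sub by blast
    have "(\<lambda>n. prob (\<Union>i<n. a i)) \<longlonglongrightarrow> prob (\<Union>n. \<Union>i<n. a i)"
      using a by (intro finite_Lim_measure_incseq) (auto simp: incseq_def, force)
    moreover have "(\<Union>n. \<Union>i<n. a i) = (\<Union>i. a i)" by auto
    ultimately have lim: "(\<lambda>n. prob (\<Union>i<n. a i)) \<longlonglongrightarrow> prob (\<Union>i. a i)" by simp
    have "\<forall>\<^sub>F n in sequentially. prob (\<Union>i. a i) - e / 2 < prob (\<Union>i<n. a i)"
      using Union.prems by (intro order_tendstoD(1)[OF lim]) simp
    then obtain N where N: "prob (\<Union>i. a i) - e / 2 < prob (\<Union>i<N. a i)"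
      unfolding eventually_sequentially by blast
    \<comment> \<open>Half of \<open>e\<close> is spent on cutting the union off at
      \<open>N\<close>, the other half on the \<open>N\<close> approximations; the
      \<open>+ 1\<close> covers \<open>N = 0\<close>.\<close>
    define d where "d = e / (2 * (N + 1))"
    have d: "0 < d" using Union.prems by (simp add: d_def)
    have "N * d \<le> (N + 1) * d" using d by simp
    also have "\<dots> = e / 2" by (simp add: d_def field_simps)
    finally have Nd: "N * d \<le> e / 2" .
    have "\<forall>i. \<exists>L G. {p \<in> space M. G (?w L p)} \<in> sets M \<and> prob {p \<in> space M. (p \<in> a i) \<noteq> G (?w L p)} < d"
      using Union.IH[OF d] by (rule allI)
    from choice[OF this] obtain L where "\<forall>i. \<exists>G. {p \<in> space M. G (?w (L i) p)} \<in> sets M \<and>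
        prob {p \<in> space M. (p \<in> a i) \<noteq> G (?w (L i) p)} < d" ..
    from choice[OF this] obtain G where GG: "\<forall>i. {p \<in> space M. G i (?w (L i) p)} \<in> sets M \<and>
        prob {p \<in> space M. (p \<in> a i) \<noteq> G i (?w (L i) p)} < d" ..
    then have G: "{p \<in> space M. G i (?w (L i) p)} \<in> sets M"
      "prob {p \<in> space M. (p \<in> a i) \<noteq> G i (?w (L i) p)} < d" for i by simp_all
    define L' where "L' = (\<Sum>i<N. L i)"
    have L': "L i \<le> L'" if "i < N" for i unfolding L'_def using that by (intro member_le_sum) auto
    define G' where "G' v \<longleftrightarrow> (\<exists>i<N. G i (take (L i) v))" for v
    have G'_iff: "G' (?w L' p) \<longleftrightarrow> (\<exists>i<N. G i (?w (L i) p))" for p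
      unfolding G'_def by (simp only: tk[OF L'] cong: conj_cong)
    let ?D = "\<lambda>i. {p \<in> space M. (p \<in> a i) \<noteq> G i (?w (L i) p)}"
    have D: "?D i \<in> sets M" for i
      using a G(1) by (rule sets_differ)
    let ?T = "(\<Union>i. a i) - (\<Union>i<N. a i)"
    have T: "?T \<in> sets M" using a by auto
    have 1: "{p \<in> space M. G' (?w L' p)} \<in> sets M"
    proof -
      have "{p \<in> space M. G' (?w L' p)} = (\<Union>i<N. {p \<in> space M. G i (?w (L i) p)})"
        unfolding G'_iff by blast
      then show ?thesis using G(1) by simp
    qed
    have "prob {p \<in> space M. (p \<in> (\<Union>i. a i)) \<noteq> G' (?w L' p)} \<le> prob (?T \<union> (\<Union>i<N. ?D i))"
    proof (rule finite_measure_mono)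
      show "{p \<in> space M. (p \<in> (\<Union>i. a i)) \<noteq> G' (?w L' p)} \<subseteq> ?T \<union> (\<Union>i<N. ?D i)"
        unfolding G'_iff by blast
      show "?T \<union> (\<Union>i<N. ?D i) \<in> sets M" using T D by blast
    qed
    also have "\<dots> \<le> prob ?T + prob (\<Union>i<N. ?D i)"
      using T D by (intro measure_Un_le) auto
    also have "prob (\<Union>i<N. ?D i) \<le> (\<Sum>i<N. prob (?D i))"
      using D by (intro finite_measure_subadditive_finite) auto
    also have "\<dots> \<le> (\<Sum>i<N. d)" using G(2) by (intro sum_mono) (simp add: less_imp_le)
    also have "\<dots> \<le> e / 2" using Nd by simp
    also have "prob ?T < e / 2"
    proof -
      have "prob ?T = prob (\<Union>i. a i) - prob (\<Union>i<N. a i)"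
        using a by (intro finite_measure_Diff) auto
      then show ?thesis using N by simp
    qed
    finally show ?case using 1 by (intro exI[of _ L'] exI[of _ G']) simp
  qed
  then obtain L0 G where G: "{p \<in> space M. G (?w L0 p)} \<in> sets M"
    "prob {p \<in> space M. (p \<in> A) \<noteq> G (?w L0 p)} < e" by blast
  have AM: "A \<in> sets M" using A sub by blast
  have "{p \<in> space M. (p \<in> A) \<noteq> G (?w L0 p)} \<in> sets M"
    using AM G(1) by (rule sets_differ)
  moreover have tk0: "(G \<circ> take L0) (?w L p) = G (?w L0 p)" if "L0 \<le> L" for L p
    using tk[OF that] by simp
  ultimately have "\<forall>L\<ge>L0. {p \<in> space M. (p \<in> A) \<noteq> (G \<circ> take L0) (?w L p)} \<in> sets M
    \<and> prob {p \<in> space M. (p \<in> A) \<noteq> (G \<circ> take L0) (?w L p)} < e"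
    using G(2) by (intro allI impI) (simp only: tk0 simp_thms)
  then show ?thesis by blast
qed

text \<open>The set of mismatches is itself a function of small entropy. Together with the word of
  length \<open>L\<close> it restores membership in every \<open>Q A\<close> exactly, so an
  approximation becomes exact information at small cost.\<close>

lemma cylinder_approx_finite:
  fixes c :: "nat \<Rightarrow> 'a \<Rightarrow> 'b"
  defines "Gen \<equiv> {c n -` {x} \<inter> space M | n x. True}"
  assumes gens: "Gen \<subseteq> sets M" and \<A>: "finite \<A>" "\<And>A. A \<in> \<A> \<Longrightarrow> Q A \<in> sigma_sets (space M) Gen"
    and e: "0 < e"
  shows "\<exists>L0. \<forall>L\<ge>L0. \<exists>G.
     simple_function M (\<lambda>p. {A \<in> \<A>. (p \<in> Q A) \<noteq> G A (map (\<lambda>i. c i p) [0..<L])}) \<and>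
     fun_entropy M (\<lambda>p. {A \<in> \<A>. (p \<in> Q A) \<noteq> G A (map (\<lambda>i. c i p) [0..<L])}) \<le> e"
proof -
  let ?w = "\<lambda>L p. map (\<lambda>i. c i p) [0..<L]"
  \<comment> \<open>Chosen so that \<open>3 * sqrt d = e / (card \<A> + 1)\<close>, the share of one
    member of \<open>\<A>\<close> in the bound of \<open>fun_entropy_bool_le_sqrt\<close>.\<close>
  define d where "d = (e / (3 * (card \<A> + 1)))\<^sup>2"
  have d: "0 < d" using e by (simp add: d_def)
  define good where "good A L G \<longleftrightarrow> {p \<in> space M. (p \<in> Q A) \<noteq> G (?w L p)} \<in> sets M
    \<and> prob {p \<in> space M. (p \<in> Q A) \<noteq> G (?w L p)} < d" for A L G
  have "\<forall>A\<in>\<A>. \<exists>L0. \<forall>L\<ge>L0. \<exists>G. good A L G"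
    unfolding good_def using cylinder_approx[OF gens[unfolded Gen_def] \<A>(2)[unfolded Gen_def] d] by (rule ballI)
  from bchoice[OF this] obtain L0 where L0: "\<forall>A\<in>\<A>. \<forall>L\<ge>L0 A. \<exists>G. good A L G" ..
  show ?thesis
  proof (intro exI[of _ "sum L0 \<A>"] allI impI)
    fix L assume L: "sum L0 \<A> \<le> L"
    have "\<forall>A\<in>\<A>. \<exists>G. good A L G"
    proof
      fix A assume A: "A \<in> \<A>"
      have "L0 A \<le> sum L0 \<A>" using A \<A>(1) by (intro member_le_sum) auto
      then show "\<exists>G. good A L G" using L0 A L by simp
    qed
    from bchoice[OF this] obtain G where "\<forall>A\<in>\<A>. good A L (G A)" ..
    then have G: "{p \<in> space M. (p \<in> Q A) \<noteq> G A (?w L p)} \<in> sets M"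
      "prob {p \<in> space M. (p \<in> Q A) \<noteq> G A (?w L p)} < d" if "A \<in> \<A>" for A
      using that by (simp_all add: good_def)
    have small: "fun_entropy M (\<lambda>p. (p \<in> Q A) \<noteq> G A (?w L p)) \<le> e / (card \<A> + 1)" if A: "A \<in> \<A>" for A
    proof -
      have "sqrt (prob {p \<in> space M. (p \<in> Q A) \<noteq> G A (?w L p)}) \<le> sqrt d"
        using G(2)[OF A] by simp
      also have "sqrt d = e / (3 * (card \<A> + 1))" using e by (simp add: d_def)
      finally have "3 * sqrt (prob {p \<in> space M. (p \<in> Q A) \<noteq> G A (?w L p)}) \<le> 3 * (e / (3 * (card \<A> + 1)))"
        by simp
      also have "\<dots> = e / (card \<A> + 1)" by (simp add: field_simps)
      finally show ?thesis using fun_entropy_bool_le_sqrt(2)[OF G(1)[OF A]] by linarith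
    qed
    let ?E = "\<lambda>p. {A \<in> \<A>. (p \<in> Q A) \<noteq> G A (?w L p)}"
    have F: "simple_function M ?E \<and> fun_entropy M ?E \<le> (\<Sum>A\<in>\<A>. fun_entropy M (\<lambda>p. (p \<in> Q A) \<noteq> G A (?w L p)))"
      using \<A>(1) fun_entropy_bool_le_sqrt(1)[OF G(1)] by (rule fun_entropy_set_le_sum)
    have "(\<Sum>A\<in>\<A>. fun_entropy M (\<lambda>p. (p \<in> Q A) \<noteq> G A (?w L p))) \<le> (\<Sum>A\<in>\<A>. e / (card \<A> + 1))"
      by (intro sum_mono small)
    also have "\<dots> \<le> e" using e by (simp add: field_simps)
    finally have "simple_function M ?E \<and> fun_entropy M ?E \<le> e" using F by linarith
    then show "\<exists>G. simple_function M (\<lambda>p. {A \<in> \<A>. (p \<in> Q A) \<noteq> G A (?w L p)}) \<and>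
      fun_entropy M (\<lambda>p. {A \<in> \<A>. (p \<in> Q A) \<noteq> G A (?w L p)}) \<le> e" by (rule exI[of _ G])
  qed
qed

end

section \<open>The random map and its digit sequences\<close>

lemma sh_funpow: "(sh ^^ n) b k = b (k + n)"
  by (induction n arbitrary: k) (auto simp: sh_def)

locale random_beta =
  fixes \<beta> :: real
  assumes beta_gt1: "1 < \<beta>" and beta_lt: "\<beta> < 3/2"
begin

abbreviation "zz p \<equiv> snd (snd p)"
abbreviation "Om \<equiv> {w :: nat \<Rightarrow> nat. \<forall>n. w n \<in> {0, 1}}"
abbreviation "Up \<equiv> {u :: nat \<Rightarrow> nat. \<forall>n. u n \<in> {0, 1, 2}}"

text \<open>The coin value that makes digit \<open>d\<close> occur at a point of
  \<open>Cset\<close>: coin 1 selects the larger digit offered. Digit 2 is always the larger one,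
  digit 1 only on \<open>C01\<close>.\<close>

definition choice :: "real \<times> real \<Rightarrow> nat \<Rightarrow> nat" where
  "choice z d = (if d = 2 \<or> d = 1 \<and> z \<in> C01 \<beta> then 1 else 0)"

lemma beta_pos: "0 < \<beta>" using beta_gt1 by simp

lemma s_gt2: "2 < 1 / (\<beta> - 1)"
  using beta_gt1 beta_lt by (simp add: field_simps)

text \<open>With \<open>X = \<beta> * x\<close>, \<open>Y = \<beta> * y\<close> and
  \<open>s = 1 / (\<beta> - 1)\<close>, all region boundaries become \<open>X = 1\<close>,
  \<open>Y = 1\<close> and \<open>X + Y = s\<close>, and the hypotenuse becomes
  \<open>X + Y = s + 1\<close>, because \<open>\<beta> * s = s + 1\<close>.\<close>

lemma scaled_iff:
  "x < 1 / \<beta> \<longleftrightarrow> \<beta> * x < 1"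
  "1 / \<beta> \<le> x \<longleftrightarrow> 1 \<le> \<beta> * x"
  "x + y \<le> 1 / (\<beta> - 1) \<longleftrightarrow> \<beta> * x + \<beta> * y \<le> 1 / (\<beta> - 1) + 1"
  "x + y \<le> 1 / (\<beta> * (\<beta> - 1)) \<longleftrightarrow> \<beta> * x + \<beta> * y \<le> 1 / (\<beta> - 1)"
  "1 / (\<beta> * (\<beta> - 1)) < x + y \<longleftrightarrow> 1 / (\<beta> - 1) < \<beta> * x + \<beta> * y"
proof -
  have t: "1 / (\<beta> * (\<beta> - 1)) = (1 / (\<beta> - 1)) / \<beta>" by simp
  have s: "1 / (\<beta> - 1) + 1 = \<beta> * (1 / (\<beta> - 1))" using beta_gt1 by (simp add: field_simps)
  have d: "\<beta> * x + \<beta> * y = \<beta> * (x + y)" by (simp add: algebra_simps)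
  show "x < 1 / \<beta> \<longleftrightarrow> \<beta> * x < 1" "1 / \<beta> \<le> x \<longleftrightarrow> 1 \<le> \<beta> * x"
    using beta_pos by (simp_all add: pos_less_divide_eq pos_divide_le_eq mult.commute)
  show "x + y \<le> 1 / (\<beta> - 1) \<longleftrightarrow> \<beta> * x + \<beta> * y \<le> 1 / (\<beta> - 1) + 1"
    unfolding s d using mult_le_cancel_left_pos[OF beta_pos] by blast
  show "x + y \<le> 1 / (\<beta> * (\<beta> - 1)) \<longleftrightarrow> \<beta> * x + \<beta> * y \<le> 1 / (\<beta> - 1)"
    unfolding t d by (simp only: pos_le_divide_eq[OF beta_pos] mult.commute)
  show "1 / (\<beta> * (\<beta> - 1)) < x + y \<longleftrightarrow> 1 / (\<beta> - 1) < \<beta> * x + \<beta> * y"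
    unfolding t d by (simp only: pos_divide_less_eq[OF beta_pos] mult.commute)
qed

lemmas region_defs = E0_def E1_def E2_def C01_def C12_def C02_def C012_def

lemma admissible_iff:
  "(\<beta> * x, \<beta> * y) - q 0 \<in> Sb \<beta> \<longleftrightarrow> 0 \<le> \<beta> * x \<and> 0 \<le> \<beta> * y \<and> \<beta> * x + \<beta> * y \<le> 1 / (\<beta> - 1)"
  "(\<beta> * x, \<beta> * y) - q 1 \<in> Sb \<beta> \<longleftrightarrow> 1 \<le> \<beta> * x \<and> 0 \<le> \<beta> * y \<and> \<beta> * x + \<beta> * y \<le> 1 / (\<beta> - 1) + 1"
  "(\<beta> * x, \<beta> * y) - q (Suc 0) \<in> Sb \<beta> \<longleftrightarrow> 1 \<le> \<beta> * x \<and> 0 \<le> \<beta> * y \<and> \<beta> * x + \<beta> * y \<le> 1 / (\<beta> - 1) + 1"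
  "(\<beta> * x, \<beta> * y) - q 2 \<in> Sb \<beta> \<longleftrightarrow> 0 \<le> \<beta> * x \<and> 1 \<le> \<beta> * y \<and> \<beta> * x + \<beta> * y \<le> 1 / (\<beta> - 1) + 1"
  by (auto simp: Sb_def q_def)

lemma region_iff:
  assumes "(x, y) \<in> Sb \<beta>"
  shows
  "(x, y) \<in> E0 \<beta> \<longleftrightarrow> \<beta> * x < 1 \<and> \<beta> * y < 1"
  "(x, y) \<in> E1 \<beta> \<longleftrightarrow> \<beta> * y < 1 \<and> 1 / (\<beta> - 1) < \<beta> * x + \<beta> * y"
  "(x, y) \<in> E2 \<beta> \<longleftrightarrow> \<beta> * x < 1 \<and> 1 / (\<beta> - 1) < \<beta> * x + \<beta> * y"
  "(x, y) \<in> C01 \<beta> \<longleftrightarrow> 1 \<le> \<beta> * x \<and> \<beta> * y < 1 \<and> \<beta> * x + \<beta> * y \<le> 1 / (\<beta> - 1)"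
  "(x, y) \<in> C12 \<beta> \<longleftrightarrow> 1 \<le> \<beta> * x \<and> 1 \<le> \<beta> * y \<and> 1 / (\<beta> - 1) < \<beta> * x + \<beta> * y"
  "(x, y) \<in> C02 \<beta> \<longleftrightarrow> \<beta> * x < 1 \<and> 1 \<le> \<beta> * y \<and> \<beta> * x + \<beta> * y \<le> 1 / (\<beta> - 1)"
  "(x, y) \<in> C012 \<beta> \<longleftrightarrow> 1 \<le> \<beta> * x \<and> 1 \<le> \<beta> * y \<and> \<beta> * x + \<beta> * y \<le> 1 / (\<beta> - 1)"
  using assms by (auto simp: region_defs Sb_def scaled_iff)

lemma Sb_iff:
  "(x, y) \<in> Sb \<beta> \<longleftrightarrow> 0 \<le> \<beta> * x \<and> 0 \<le> \<beta> * y \<and> \<beta> * x + \<beta> * y \<le> 1 / (\<beta> - 1) + 1"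
  using beta_pos by (simp add: Sb_def scaled_iff zero_le_mult_iff)

lemma space_Mb: "space (Mb \<beta>) = Om \<times> (Up \<times> Sb \<beta>)"
proof -
  have "space Omega_M = Om" "space Ups_M = Up"
    by (simp_all add: Omega_M_def Ups_M_def space_PiM PiE_def Pi_def)
  then show ?thesis by (simp add: Mb_def S_M_def space_pair_measure space_restrict_space)
qed

text \<open>The last two claims are the source of invertibility: a consumed coin can be read off the
  digit. The proof splits by the sides of the three lines; \<open>s > 2\<close> excludes
  \<open>X < 1\<close>, \<open>Y < 1\<close>, \<open>X + Y > s\<close> and leaves the seven
  regions.\<close>

lemma Kd_step:
  assumes "(w, u, z) \<in> space (Mb \<beta>)"
  defines "d \<equiv> digit1 \<beta> (w, u, z)"
  shows "Kb \<beta> (w, u, z) = (if z \<in> Cset \<beta> then sh w else w, if z \<in> C012 \<beta> then sh u else u, \<beta> *\<^sub>R z - q d)"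
    and "d \<in> {0, 1, 2}" and "\<beta> *\<^sub>R z - q d \<in> Sb \<beta>"
    and "z \<in> Cset \<beta> \<Longrightarrow> w 0 = choice z d" and "z \<in> C012 \<beta> \<Longrightarrow> u 0 = d"
proof -
  obtain x y where z: "z = (x, y)" by force
  have S: "(x, y) \<in> Sb \<beta>" and w: "w 0 \<in> {0, 1}" and u: "u 0 \<in> {0, 1, 2}"
    using assms(1) unfolding space_Mb z by auto
  note s2 = s_gt2
  note r = region_iff[OF S] and a = admissible_iff
  let ?P = "Kb \<beta> (w, u, z) = (if z \<in> Cset \<beta> then sh w else w, if z \<in> C012 \<beta> then sh u else u, \<beta> *\<^sub>R z - q d)
    \<and> d \<in> {0, 1, 2} \<and> \<beta> *\<^sub>R z - q d \<in> Sb \<beta> \<and> (z \<in> Cset \<beta> \<longrightarrow> w 0 = choice z d) \<and> (z \<in> C012 \<beta> \<longrightarrow> u 0 = d)"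
  define X where "X = \<beta> * x"
  define Y where "Y = \<beta> * y"
  define s where "s = 1 / (\<beta> - 1)"
  note r' = r[folded X_def Y_def s_def] and a' = a[of x y, folded X_def Y_def s_def]
  have S': "0 \<le> X" "0 \<le> Y" "X + Y \<le> s + 1" "s > 2"
    using S[unfolded Sb_iff] s2 unfolding X_def Y_def s_def by auto
  have C: "(x, y) \<in> Cset \<beta> \<longleftrightarrow> (x, y) \<in> C01 \<beta> \<or> (x, y) \<in> C12 \<beta> \<or> (x, y) \<in> C02 \<beta>"
    by (auto simp: Cset_def)
  have ?P
    unfolding z d_def Kb_def digit1_def Kd_def C choice_def
    using S' w u
    by (cases "X < 1"; cases "Y < 1"; cases "X + Y \<le> s")
       (auto simp: r' a' X_def[symmetric] Y_def[symmetric] split: if_splits)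
  then show "Kb \<beta> (w, u, z) = (if z \<in> Cset \<beta> then sh w else w, if z \<in> C012 \<beta> then sh u else u, \<beta> *\<^sub>R z - q d)"
    and "d \<in> {0, 1, 2}" and "\<beta> *\<^sub>R z - q d \<in> Sb \<beta>"
    and "z \<in> Cset \<beta> \<Longrightarrow> w 0 = choice z d" and "z \<in> C012 \<beta> \<Longrightarrow> u 0 = d" by auto
qed

text \<open>In each region the digits that keep the point in the triangle are exactly those on
  offer, and the coin, if one is read, singles out one of them. This allows an orbit to be
  prescribed by its digits.\<close>

lemma digit1_unique:
  assumes "(w, u, z) \<in> space (Mb \<beta>)" "d \<in> {0, 1, 2}" "\<beta> *\<^sub>R z - q d \<in> Sb \<beta>"
    and "z \<in> Cset \<beta> \<Longrightarrow> w 0 = choice z d" and "z \<in> C012 \<beta> \<Longrightarrow> u 0 = d"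
  shows "digit1 \<beta> (w, u, z) = d"
proof -
  obtain x y where z: "z = (x, y)" by force
  have S: "(x, y) \<in> Sb \<beta>" and w: "w 0 \<in> {0, 1}" and u: "u 0 \<in> {0, 1, 2}"
    using assms(1) unfolding space_Mb z by auto
  define X where "X = \<beta> * x"
  define Y where "Y = \<beta> * y"
  define s where "s = 1 / (\<beta> - 1)"
  note r' = region_iff[OF S, folded X_def Y_def s_def]
    and a' = admissible_iff[of x y, folded X_def Y_def s_def]
  have S': "0 \<le> X" "0 \<le> Y" "X + Y \<le> s + 1" "s > 2"
    using S[unfolded Sb_iff] s_gt2 unfolding X_def Y_def s_def by auto
  have C: "(x, y) \<in> Cset \<beta> \<longleftrightarrow> (x, y) \<in> C01 \<beta> \<or> (x, y) \<in> C12 \<beta> \<or> (x, y) \<in> C02 \<beta>"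
    by (auto simp: Cset_def)
  show ?thesis
    using S' w u assms(2-) unfolding z digit1_def Kd_def C choice_def
    by (cases "X < 1"; cases "Y < 1"; cases "X + Y \<le> s")
       (auto simp: r' a' X_def[symmetric] Y_def[symmetric] split: if_splits)
qed

lemma Kb_space: "p \<in> space (Mb \<beta>) \<Longrightarrow> Kb \<beta> p \<in> space (Mb \<beta>)"
proof -
  assume p: "p \<in> space (Mb \<beta>)"
  obtain w u z where pp: "p = (w, u, z)" by (cases p) auto
  show ?thesis
    using Kd_step(1,3)[OF p[unfolded pp]] p unfolding pp by (auto simp: space_Mb sh_def)
qed

lemma Kb_funpow_space: "p \<in> space (Mb \<beta>) \<Longrightarrow> (Kb \<beta> ^^ n) p \<in> space (Mb \<beta>)"
  by (induction n) (auto simp: Kb_space)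

lemma phib_funpow: "phib \<beta> ((Kb \<beta> ^^ n) p) k = phib \<beta> p (k + n)"
  by (simp add: phib_def funpow_add)

lemma phib_Kb: "phib \<beta> (Kb \<beta> p) = sh (phib \<beta> p)"
  using phib_funpow[of 1 p] by (auto simp: sh_def fun_eq_iff)

lemma digit1_range: "p \<in> space (Mb \<beta>) \<Longrightarrow> digit1 \<beta> p \<in> {0, 1, 2}"
  using Kd_step(2)[of "fst p" "fst (snd p)" "zz p"] by simp

lemma phib_Up: "p \<in> space (Mb \<beta>) \<Longrightarrow> phib \<beta> p \<in> Up"
  using digit1_range[OF Kb_funpow_space] by (simp add: phib_def)

section \<open>Positions as expansions of digit sequences\<close>

definition pi1 :: "(nat \<Rightarrow> nat) \<Rightarrow> real" where
  "pi1 b = (\<Sum>n. of_bool (b n = 1) / \<beta> ^ Suc n)"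

definition pi2 :: "(nat \<Rightarrow> nat) \<Rightarrow> real" where
  "pi2 b = (\<Sum>n. of_bool (b n = 2) / \<beta> ^ Suc n)"

text \<open>The point with digit expansion \<open>b\<close>, that is, the sum of
  \<open>q (b n) / \<beta> ^ (n + 1)\<close>; the exponent is shifted because digits are indexed
  from 0.\<close>

definition pib :: "(nat \<Rightarrow> nat) \<Rightarrow> real \<times> real" where
  "pib b = (pi1 b, pi2 b)"

lemma geometric_beta: "(\<lambda>n. 1 / \<beta> ^ Suc n) sums (1 / (\<beta> - 1))"
proof -
  have "(\<lambda>n. (1 / \<beta>) * (1 / \<beta>) ^ n) sums ((1 / \<beta>) * (1 / (1 - 1 / \<beta>)))"
    using beta_gt1 by (intro sums_mult geometric_sums) auto
  also have "(1 / \<beta>) * (1 / (1 - 1 / \<beta>)) = 1 / (\<beta> - 1)" using beta_gt1 by (simp add: field_simps)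
  finally show ?thesis by (simp add: power_one_over)
qed

lemma summable_digits: "summable (\<lambda>n. of_bool (P n) / \<beta> ^ Suc n)"
  by (rule summable_comparison_test[OF _ sums_summable[OF geometric_beta]])
     (use beta_pos in \<open>auto intro!: exI[of _ 0]\<close>)

lemma suminf_digits_shift:
  "(\<Sum>n. of_bool (P n) / \<beta> ^ Suc n) = (of_bool (P 0) + (\<Sum>n. of_bool (P (Suc n)) / \<beta> ^ Suc n)) / \<beta>"
proof -
  have "(\<Sum>n. of_bool (P n) / \<beta> ^ Suc n)
      = of_bool (P 0) / \<beta> + (\<Sum>n. of_bool (P (Suc n)) / \<beta> ^ Suc (Suc n))"
    using suminf_split_head[OF summable_digits[of P]] by simp
  also have "(\<Sum>n. of_bool (P (Suc n)) / \<beta> ^ Suc (Suc n)) = (\<Sum>n. (of_bool (P (Suc n)) / \<beta> ^ Suc n) / \<beta>)"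
    by (simp add: mult.commute)
  also have "\<dots> = (\<Sum>n. of_bool (P (Suc n)) / \<beta> ^ Suc n) / \<beta>"
    by (rule suminf_divide[OF summable_digits])
  finally show ?thesis by (simp add: add_divide_distrib)
qed

lemma pib_sh:
  assumes "b \<in> Up"
  shows "pib (sh b) = \<beta> *\<^sub>R pib b - q (b 0)"
proof -
  have "b 0 \<in> {0, 1, 2}" using assms by simp
  then show ?thesis
    using suminf_digits_shift[of "\<lambda>n. b n = 1"] suminf_digits_shift[of "\<lambda>n. b n = 2"] beta_pos
    by (auto simp: pib_def pi1_def pi2_def sh_def q_def)
qed

lemma pib_Sb: "pib b \<in> Sb \<beta>"
proof -
  have "0 \<le> pi1 b" "0 \<le> pi2 b"
    unfolding pi1_def pi2_def using beta_pos by (auto intro!: suminf_nonneg summable_digits simp del: power_Suc)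
  moreover have "pi1 b + pi2 b = (\<Sum>n. of_bool (b n = 1) / \<beta> ^ Suc n + of_bool (b n = 2) / \<beta> ^ Suc n)"
    unfolding pi1_def pi2_def by (rule suminf_add[OF summable_digits summable_digits])
  moreover have "\<dots> \<le> (\<Sum>n. 1 / \<beta> ^ Suc n)"
    using beta_pos
    by (intro suminf_le summable_add summable_digits sums_summable[OF geometric_beta]) auto
  moreover have "\<dots> = 1 / (\<beta> - 1)" using geometric_beta by (simp add: sums_iff)
  ultimately show ?thesis by (simp add: Sb_def pib_def)
qed

lemma Sb_bound:
  assumes "z \<in> Sb \<beta>" "z' \<in> Sb \<beta>"
  shows "\<bar>fst z - fst z'\<bar> \<le> 1 / (\<beta> - 1)" "\<bar>snd z - snd z'\<bar> \<le> 1 / (\<beta> - 1)"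
  using assms by (auto simp: Sb_def)

text \<open>Under common digits the difference grows by the factor \<open>\<beta>\<close> in each
  step, yet both sequences stay in a bounded triangle, so they started close. Large \<open>N\<close>
  identifies a point with its expansion; fixed \<open>N\<close> shows that a common prefix forces
  proximity.\<close>

lemma expansion_distance:
  fixes f g :: "nat \<Rightarrow> real \<times> real"
  assumes "\<And>n. f n \<in> Sb \<beta>" "\<And>n. g n \<in> Sb \<beta>"
    and "\<And>n. n < N \<Longrightarrow> f (Suc n) - g (Suc n) = \<beta> *\<^sub>R (f n - g n)"
  shows "\<bar>fst (f 0) - fst (g 0)\<bar> \<le> (1 / (\<beta> - 1)) / \<beta> ^ N"
    and "\<bar>snd (f 0) - snd (g 0)\<bar> \<le> (1 / (\<beta> - 1)) / \<beta> ^ N"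
proof -
  have "f n - g n = \<beta> ^ n *\<^sub>R (f 0 - g 0)" if "n \<le> N" for n
    using that by (induction n) (auto simp: assms(3))
  from this[of N] have "fst (f N) - fst (g N) = \<beta> ^ N * (fst (f 0) - fst (g 0))"
    "snd (f N) - snd (g N) = \<beta> ^ N * (snd (f 0) - snd (g 0))"
    by (auto simp: prod_eq_iff)
  then show "\<bar>fst (f 0) - fst (g 0)\<bar> \<le> (1 / (\<beta> - 1)) / \<beta> ^ N"
     "\<bar>snd (f 0) - snd (g 0)\<bar> \<le> (1 / (\<beta> - 1)) / \<beta> ^ N"
    using Sb_bound[OF assms(1) assms(2), of N N] beta_pos
    by (simp_all only: pos_le_divide_eq zero_less_power abs_mult power_abs abs_of_pos mult.commute)
qed

lemma sh_funpow_Up: "b \<in> Up \<Longrightarrow> (sh ^^ n) b \<in> Up"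
  by (simp add: sh_funpow)

lemma zz_Kb:
  assumes "p \<in> space (Mb \<beta>)"
  shows "zz (Kb \<beta> p) = \<beta> *\<^sub>R zz p - q (digit1 \<beta> p)"
proof -
  obtain w u z where pp: "p = (w, u, z)" by (cases p) auto
  show ?thesis using Kd_step(1)[of w u z] assms unfolding pp by simp
qed

lemma zz_Sb: "p \<in> space (Mb \<beta>) \<Longrightarrow> zz p \<in> Sb \<beta>"
  by (auto simp: space_Mb)

text \<open>Positions along the orbit and expansions of the shifted digits obey the same recursion,
  so \<open>expansion_distance\<close> applies for every \<open>N\<close>. The position is thus
  redundant once all digits are known.\<close>

lemma zz_eq_pib:
  assumes p: "p \<in> space (Mb \<beta>)"
  shows "zz p = pib (phib \<beta> p)"
proof -
  let ?f = "\<lambda>n. zz ((Kb \<beta> ^^ n) p)" and ?g = "\<lambda>n. pib ((sh ^^ n) (phib \<beta> p))"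
  have step: "?f (Suc n) - ?g (Suc n) = \<beta> *\<^sub>R (?f n - ?g n)" for n
    using zz_Kb[OF Kb_funpow_space[OF p, of n]] pib_sh[OF sh_funpow_Up[OF phib_Up[OF p]], of n]
    by (simp add: sh_funpow phib_def scaleR_diff_right)
  have lim: "(\<lambda>N. (1 / (\<beta> - 1)) / \<beta> ^ N) \<longlonglongrightarrow> 0"
    by (rule LIMSEQ_divide_realpow_zero[OF beta_gt1])
  have "\<bar>fst (zz p) - fst (pib (phib \<beta> p))\<bar> \<le> (1 / (\<beta> - 1)) / \<beta> ^ N"
       "\<bar>snd (zz p) - snd (pib (phib \<beta> p))\<bar> \<le> (1 / (\<beta> - 1)) / \<beta> ^ N" for N
    using expansion_distance[of ?f ?g N, OF zz_Sb[OF Kb_funpow_space[OF p]] pib_Sb step] by auto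
  then have "\<bar>fst (zz p) - fst (pib (phib \<beta> p))\<bar> \<le> 0" "\<bar>snd (zz p) - snd (pib (phib \<beta> p))\<bar> \<le> 0"
    using LIMSEQ_le_const[OF lim] by blast+
  then show ?thesis by (simp add: prod_eq_iff)
qed

lemma zz_funpow_eq_pib:
  assumes p: "p \<in> space (Mb \<beta>)"
  shows "zz ((Kb \<beta> ^^ n) p) = pib ((sh ^^ n) (phib \<beta> p))"
proof -
  have "phib \<beta> ((Kb \<beta> ^^ n) p) = (sh ^^ n) (phib \<beta> p)"
    by (simp add: fun_eq_iff phib_funpow sh_funpow)
  then show ?thesis using zz_eq_pib[OF Kb_funpow_space[OF p, of n]] by simp
qed

end

text \<open>Only times strictly before \<open>n\<close> count, so a visit at time \<open>n\<close>
  consumes the coin with index \<open>visits V n\<close>.\<close>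

primrec visits :: "(nat \<Rightarrow> bool) \<Rightarrow> nat \<Rightarrow> nat" where
  "visits V 0 = 0"
| "visits V (Suc n) = (if V n then Suc (visits V n) else visits V n)"

lemma visits_mono: "m \<le> n \<Longrightarrow> visits V m \<le> visits V n"
  by (rule lift_Suc_mono_le[of "visits V"]) auto

lemma visits_inj:
  assumes "V m" "V n" "visits V m = visits V n"
  shows "m = n"
proof -
  have "visits V m < visits V n" if "m < n" "V m" for m n
    using visits_mono[of "Suc m" n V] that by simp
  then show ?thesis using assms by (metis less_irrefl nat_neq_iff)
qed

lemma visits_ex:
  assumes "\<exists>\<^sub>\<infinity>n. V n"
  shows "\<exists>n. V n \<and> visits V n = k"
proof -
  have "\<exists>n. k \<le> visits V n" for k
  proof (induction k)
    case (Suc k)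
    then obtain n where n: "k \<le> visits V n" by auto
    obtain m where m: "n \<le> m" "V m" using assms by (auto simp: INFM_nat_le)
    then have "Suc k \<le> visits V (Suc m)" using n visits_mono[of n m V] by simp
    then show ?case by blast
  qed simp
  then obtain n where "Suc k \<le> visits V n" by blast
  \<comment> \<open>The counter passes from \<open>k\<close> to \<open>k + 1\<close> only at a
    visit, and at that visit it still has the value \<open>k\<close>.\<close>
  moreover have "k < visits V n \<Longrightarrow> \<exists>m<n. V m \<and> visits V m = k" for n
    by (induction n) (auto simp: less_Suc_eq split: if_splits)
  ultimately show ?thesis by (auto simp: Suc_le_eq)
qed

section \<open>The inverse of the digit map\<close>

context random_beta
begin

definition visC :: "(nat \<Rightarrow> nat) \<Rightarrow> nat \<Rightarrow> bool" where
  "visC b n \<longleftrightarrow> pib ((sh ^^ n) b) \<in> Cset \<beta>"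

definition visC012 :: "(nat \<Rightarrow> nat) \<Rightarrow> nat \<Rightarrow> bool" where
  "visC012 b n \<longleftrightarrow> pib ((sh ^^ n) b) \<in> C012 \<beta>"

text \<open>Coin \<open>k\<close> as read off the digits at the visit with counter \<open>k\<close>,
  which is unique by \<open>visits_inj\<close>; the default is 0 if there is no such visit. The
  existential form keeps measurability easy.\<close>

definition psiw :: "(nat \<Rightarrow> nat) \<Rightarrow> nat \<Rightarrow> nat" where
  "psiw b k = (if \<exists>n. visC b n \<and> visits (visC b) n = k \<and> choice (pib ((sh ^^ n) b)) (b n) = 1 then 1 else 0)"

definition psiu :: "(nat \<Rightarrow> nat) \<Rightarrow> nat \<Rightarrow> nat" where
  "psiu b k = (if \<exists>n. visC012 b n \<and> visits (visC012 b) n = k \<and> b n = 1 then 1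
     else if \<exists>n. visC012 b n \<and> visits (visC012 b) n = k \<and> b n = 2 then 2 else 0)"

definition psi :: "(nat \<Rightarrow> nat) \<Rightarrow> state" where
  "psi b = (psiw b, psiu b, pib b)"

definition Zs :: "(nat \<Rightarrow> nat) set" where
  "Zs = {b \<in> Up. (\<exists>\<^sub>\<infinity>n. visC b n) \<and> (\<exists>\<^sub>\<infinity>n. visC012 b n)}"

lemma choice_01: "choice z d \<in> {0, 1}"
  by (simp add: choice_def)

lemma psiw_visit:
  assumes "visC b n"
  shows "psiw b (visits (visC b) n) = choice (pib ((sh ^^ n) b)) (b n)"
proof -
  have u: "m = n" if "visC b m" "visits (visC b) m = visits (visC b) n" for m
    using visits_inj[OF that(1) assms that(2)] .
  show ?thesis
  proof (cases "choice (pib ((sh ^^ n) b)) (b n) = 1")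
    case False
    then have "choice (pib ((sh ^^ n) b)) (b n) = 0" using choice_01 by blast
    moreover have "\<not> (\<exists>m. visC b m \<and> visits (visC b) m = visits (visC b) n \<and> choice (pib ((sh ^^ m) b)) (b m) = 1)"
      using u False by metis
    ultimately show ?thesis by (simp add: psiw_def)
  qed (use assms in \<open>auto simp: psiw_def\<close>)
qed

lemma psiu_visit:
  assumes "b \<in> Up" "visC012 b n"
  shows "psiu b (visits (visC012 b) n) = b n"
proof -
  have u: "m = n" if "visC012 b m" "visits (visC012 b) m = visits (visC012 b) n" for m
    using visits_inj[OF that(1) assms(2) that(2)] .
  then have "(\<exists>m. visC012 b m \<and> visits (visC012 b) m = visits (visC012 b) n \<and> b m = i) \<longleftrightarrow> b n = i" for i
    using assms(2) by metis
  moreover have "b n \<in> {0, 1, 2}" using assms(1) by simp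
  ultimately show ?thesis unfolding psiu_def by auto
qed

lemma psi_space: "psi b \<in> space (Mb \<beta>)"
  by (auto simp: space_Mb psi_def psiw_def psiu_def pib_Sb)

lemma sh_shift: "sh (\<lambda>k. w (k + m)) = (\<lambda>k. w (k + Suc m))"
  by (simp add: sh_def)

text \<open>Coins are only ever deleted from the front, one per visit, so the coin sequences at time
  \<open>n\<close> are shifts by the visit counts.\<close>

lemma orbit:
  assumes p: "p \<in> space (Mb \<beta>)"
  shows "(Kb \<beta> ^^ n) p = (\<lambda>k. fst p (k + visits (visC (phib \<beta> p)) n),
     \<lambda>k. fst (snd p) (k + visits (visC012 (phib \<beta> p)) n), pib ((sh ^^ n) (phib \<beta> p)))"
proof (induction n)
  case 0 show ?case using zz_eq_pib[OF p] by (cases p) auto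
next
  case (Suc n)
  have "(Kb \<beta> ^^ n) p \<in> space (Mb \<beta>)" by (rule Kb_funpow_space[OF p])
  then have "Kb \<beta> ((Kb \<beta> ^^ n) p) = (if visC (phib \<beta> p) n then sh (fst ((Kb \<beta> ^^ n) p)) else fst ((Kb \<beta> ^^ n) p),
     if visC012 (phib \<beta> p) n then sh (fst (snd ((Kb \<beta> ^^ n) p))) else fst (snd ((Kb \<beta> ^^ n) p)), zz ((Kb \<beta> ^^ Suc n) p))"
    using Kd_step(1)[of "fst ((Kb \<beta> ^^ n) p)" "fst (snd ((Kb \<beta> ^^ n) p))" "zz ((Kb \<beta> ^^ n) p)"]
    by (simp add: visC_def visC012_def zz_funpow_eq_pib[OF p, symmetric])
  then show ?case
    unfolding zz_funpow_eq_pib[OF p] by (simp add: Suc sh_shift)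
qed

lemma orbit_choice:
  assumes p: "p \<in> space (Mb \<beta>)"
  defines "b \<equiv> phib \<beta> p"
  shows "visC b n \<Longrightarrow> fst p (visits (visC b) n) = choice (pib ((sh ^^ n) b)) (b n)"
    and "visC012 b n \<Longrightarrow> fst (snd p) (visits (visC012 b) n) = b n"
proof -
  have d: "digit1 \<beta> ((Kb \<beta> ^^ n) p) = b n" by (simp add: b_def phib_def)
  note s = Kd_step[OF Kb_funpow_space[OF p, of n, unfolded orbit[OF p]], folded orbit[OF p] b_def, unfolded d]
  show "visC b n \<Longrightarrow> fst p (visits (visC b) n) = choice (pib ((sh ^^ n) b)) (b n)"
    using s(4) by (simp add: visC_def)
  show "visC012 b n \<Longrightarrow> fst (snd p) (visits (visC012 b) n) = b n"
    using s(5) by (simp add: visC012_def)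
qed

text \<open>Infinitely many visits of both kinds mean that every coin is consumed eventually, and
  \<open>orbit_choice\<close> reads off each consumed coin.\<close>

lemma psi_phib:
  assumes p: "p \<in> space (Mb \<beta>)" and Z: "phib \<beta> p \<in> Zs"
  shows "psi (phib \<beta> p) = p"
proof -
  let ?b = "phib \<beta> p"
  have "psiw ?b k = fst p k" for k
    using visits_ex[of "visC ?b" k] Z orbit_choice(1)[OF p] psiw_visit[of ?b] by (auto simp: Zs_def)
  moreover have "psiu ?b k = fst (snd p) k" for k
    using visits_ex[of "visC012 ?b" k] Z orbit_choice(2)[OF p] psiu_visit[OF phib_Up[OF p]] by (auto simp: Zs_def)
  ultimately show ?thesis
    using zz_eq_pib[OF p] by (simp add: psi_def prod_eq_iff fun_eq_iff)
qed

text \<open>Holds outside \<open>Zs\<close> as well: coins that are never consumed keep their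
  default value and do not influence the digits.\<close>

lemma phib_psi:
  assumes b: "b \<in> Up"
  shows "phib \<beta> (psi b) = b"
proof -
  \<comment> \<open>The candidate orbit, modelled on \<open>orbit\<close>;
    \<open>digit1_unique\<close> confirms its digits and \<open>Kd_step\<close> its
    dynamics.\<close>
  let ?p = "\<lambda>n. (\<lambda>k. psiw b (k + visits (visC b) n), \<lambda>k. psiu b (k + visits (visC012 b) n), pib ((sh ^^ n) b))"
  have sp: "?p n \<in> space (Mb \<beta>)" for n
    using psi_space[of b] by (auto simp: space_Mb psi_def pib_Sb)
  have bn: "b n \<in> {0, 1, 2}" for n using b by simp
  have pn: "\<beta> *\<^sub>R pib ((sh ^^ n) b) - q (b n) = pib ((sh ^^ Suc n) b)" for n
    using pib_sh[OF sh_funpow_Up[OF b, of n]] by (simp add: sh_funpow)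
  have dig: "digit1 \<beta> (?p n) = b n" for n
    by (rule digit1_unique[OF sp bn])
       (simp_all add: pn pib_Sb visC_def[symmetric] visC012_def[symmetric] psiw_visit psiu_visit[OF b] del: funpow.simps)
  have step: "Kb \<beta> (?p n) = ?p (Suc n)" for n
    unfolding Kd_step(1)[OF sp] dig pn
    by (simp add: visC_def[symmetric] visC012_def[symmetric] sh_shift del: funpow.simps)
  have "(Kb \<beta> ^^ n) (psi b) = ?p n" for n
  proof (induction n)
    case 0 show ?case by (simp add: psi_def)
  next
    case (Suc n) then show ?case using step[of n] by simp
  qed
  then show ?thesis by (simp add: phib_def dig fun_eq_iff)
qed

lemma Zb_eq: "Zb \<beta> = {p \<in> space (Mb \<beta>). phib \<beta> p \<in> Zs}"
  unfolding Zb_def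
proof (rule Collect_cong, rule conj_cong[OF refl])
  fix p assume p: "p \<in> space (Mb \<beta>)"
  show "((\<exists>\<^sub>\<infinity>n. zz ((Kb \<beta> ^^ n) p) \<in> Cset \<beta>) \<and> (\<exists>\<^sub>\<infinity>n. zz ((Kb \<beta> ^^ n) p) \<in> C012 \<beta>)) = (phib \<beta> p \<in> Zs)"
    using phib_Up[OF p] by (simp add: zz_funpow_eq_pib[OF p] Zs_def visC_def visC012_def)
qed

text \<open>Turns a forward image, whose measurability is not evident, into a condition on
  \<open>psi\<close>, a map that is shown to be measurable.\<close>

lemma phib_image:
  assumes "A \<subseteq> space (Mb \<beta>)"
  shows "phib \<beta> ` (Zb \<beta> \<inter> A) = {b \<in> Zs. psi b \<in> A}"
proof (intro equalityI subsetI)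
  fix b assume "b \<in> {b \<in> Zs. psi b \<in> A}"
  then have b: "b \<in> Zs" "psi b \<in> A" "phib \<beta> (psi b) = b" by (auto simp: Zs_def phib_psi)
  then have "psi b \<in> Zb \<beta> \<inter> A" by (simp add: Zb_eq psi_space)
  then show "b \<in> phib \<beta> ` (Zb \<beta> \<inter> A)" using b(3) by (metis image_eqI)
qed (auto simp: Zb_eq psi_phib)

end

section \<open>Measurability\<close>

lemma borel_fst_snd [measurable]:
  "fst \<in> borel_measurable (borel :: (real \<times> real) measure)"
  "snd \<in> borel_measurable (borel :: (real \<times> real) measure)"
  by (auto intro!: borel_measurable_continuous_onI continuous_intros)

lemma region_borel [measurable]:
  "Sb \<beta> \<in> sets borel" "E0 \<beta> \<in> sets borel" "E1 \<beta> \<in> sets borel" "E2 \<beta> \<in> sets borel"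
  "C01 \<beta> \<in> sets borel" "C12 \<beta> \<in> sets borel" "C02 \<beta> \<in> sets borel" "C012 \<beta> \<in> sets borel"
  "Cset \<beta> \<in> sets borel"
proof -
  have R: "{(x, y). P x y} \<in> sets borel" if "Measurable.pred borel (\<lambda>z. P (fst z) (snd z))"
    for P :: "real \<Rightarrow> real \<Rightarrow> bool"
  proof -
    have "{(x, y). P x y} = {z. P (fst z) (snd z)}" by auto
    then show ?thesis using that by (simp add: pred_def)
  qed
  show S: "Sb \<beta> \<in> sets borel"
    unfolding Sb_def by (rule R) measurable
  show "E0 \<beta> \<in> sets borel" unfolding E0_def by (rule sets.Int[OF S R]) measurable
  show "E1 \<beta> \<in> sets borel" unfolding E1_def by (rule sets.Int[OF S R]) measurable
  show "E2 \<beta> \<in> sets borel" unfolding E2_def by (rule sets.Int[OF S R]) measurable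
  show C: "C01 \<beta> \<in> sets borel" unfolding C01_def by (rule sets.Int[OF S R]) measurable
  show C': "C12 \<beta> \<in> sets borel" unfolding C12_def by (rule sets.Int[OF S R]) measurable
  show C'': "C02 \<beta> \<in> sets borel" unfolding C02_def by (rule sets.Int[OF S R]) measurable
  show "C012 \<beta> \<in> sets borel" unfolding C012_def by (rule sets.Int[OF S R]) measurable
  show "Cset \<beta> \<in> sets borel" unfolding Cset_def using C C' C'' by auto
qed

lemma sets_Pups: "sets Pups = sets Ups_M"
  unfolding Pups_def Ups_M_def
  by (rule sets_PiM_cong) (simp_all only: sets_uniform_count_measure sets_count_space)

lemma space_Pups: "space Pups = {u. \<forall>n. u n \<in> {0, 1, 2}}"
  by (simp add: Pups_def space_PiM PiE_def Pi_def space_uniform_count_measure)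

lemma space_Ups_M: "space Ups_M = {u. \<forall>n. u n \<in> {0, 1, 2}}"
  by (simp add: Ups_M_def space_PiM PiE_def Pi_def)

lemma measurable_to_count_subset:
  assumes "f \<in> N \<rightarrow>\<^sub>M count_space UNIV" "\<And>x. x \<in> space N \<Longrightarrow> f x \<in> A"
  shows "f \<in> N \<rightarrow>\<^sub>M count_space A"
proof (rule measurableI)
  fix B assume "B \<in> sets (count_space A)"
  show "f -` B \<inter> space N \<in> sets N" using assms(1) by (rule measurable_sets) simp
qed (use assms in simp)

lemma measurable_from_count_subset:
  assumes "f \<in> N \<rightarrow>\<^sub>M count_space A"
  shows "f \<in> N \<rightarrow>\<^sub>M count_space UNIV"
proof (rule measurableI)
  fix B :: "'b set"
  have "f -` B \<inter> space N = f -` (B \<inter> A) \<inter> space N"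
    using measurable_space[OF assms] by auto
  also have "\<dots> \<in> sets N" using assms by (rule measurable_sets) simp
  finally show "f -` B \<inter> space N \<in> sets N" .
qed simp

lemma Ups_M_component [measurable]: "(\<lambda>u. u n) \<in> Ups_M \<rightarrow>\<^sub>M count_space UNIV"
  unfolding Ups_M_def
  by (rule measurable_from_count_subset[where A = "{0, 1, 2}"])
     (use measurable_component_singleton[of n UNIV "\<lambda>_. count_space {0, 1, 2}"] in simp)

lemma Omega_M_component [measurable]: "(\<lambda>u. u n) \<in> Omega_M \<rightarrow>\<^sub>M count_space UNIV"
  unfolding Omega_M_def
  by (rule measurable_from_count_subset[where A = "{0, 1}"])
     (use measurable_component_singleton[of n UNIV "\<lambda>_. count_space {0, 1}"] in simp)

lemma measurable_Ups_M:
  assumes "\<And>n. (\<lambda>x. f x n) \<in> N \<rightarrow>\<^sub>M count_space UNIV" "\<And>x n. x \<in> space N \<Longrightarrow> f x n \<in> {0, 1, 2}"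
  shows "f \<in> N \<rightarrow>\<^sub>M Ups_M"
  unfolding Ups_M_def
  by (rule measurable_PiM_single', rule measurable_to_count_subset)
     (use assms in \<open>auto simp: PiE_def Pi_def\<close>)

lemma measurable_Omega_M:
  assumes "\<And>n. (\<lambda>x. f x n) \<in> N \<rightarrow>\<^sub>M count_space UNIV" "\<And>x n. x \<in> space N \<Longrightarrow> f x n \<in> {0, 1}"
  shows "f \<in> N \<rightarrow>\<^sub>M Omega_M"
  unfolding Omega_M_def
  by (rule measurable_PiM_single', rule measurable_to_count_subset)
     (use assms in \<open>auto simp: PiE_def Pi_def\<close>)

context random_beta
begin

lemma Mb_projections [measurable]:
  "(\<lambda>p. fst p n) \<in> Mb \<beta> \<rightarrow>\<^sub>M count_space UNIV"
  "(\<lambda>p. fst (snd p) n) \<in> Mb \<beta> \<rightarrow>\<^sub>M count_space UNIV"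
  "(\<lambda>p. zz p) \<in> Mb \<beta> \<rightarrow>\<^sub>M borel"
proof -
  show "(\<lambda>p. fst p n) \<in> Mb \<beta> \<rightarrow>\<^sub>M count_space UNIV" "(\<lambda>p. fst (snd p) n) \<in> Mb \<beta> \<rightarrow>\<^sub>M count_space UNIV"
    unfolding Mb_def by measurable
  have "(\<lambda>p. zz p) \<in> Mb \<beta> \<rightarrow>\<^sub>M S_M \<beta>" unfolding Mb_def by measurable
  then show "(\<lambda>p. zz p) \<in> Mb \<beta> \<rightarrow>\<^sub>M borel"
    unfolding S_M_def by (simp add: measurable_restrict_space2_iff)
qed

lemma measurable_Mb:
  assumes "\<And>n. (\<lambda>x. fst (f x) n) \<in> N \<rightarrow>\<^sub>M count_space UNIV"
    "\<And>n. (\<lambda>x. fst (snd (f x)) n) \<in> N \<rightarrow>\<^sub>M count_space UNIV"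
    "(\<lambda>x. zz (f x)) \<in> N \<rightarrow>\<^sub>M borel"
    and "\<And>x. x \<in> space N \<Longrightarrow> f x \<in> space (Mb \<beta>)"
  shows "f \<in> N \<rightarrow>\<^sub>M Mb \<beta>"
proof -
  have s: "fst (f x) \<in> Om" "fst (snd (f x)) \<in> Up" "zz (f x) \<in> Sb \<beta>" if "x \<in> space N" for x
    using assms(4)[OF that] unfolding space_Mb by (auto simp: mem_Times_iff)
  have "(\<lambda>x. fst (f x)) \<in> N \<rightarrow>\<^sub>M Omega_M"
    using s(1) by (intro measurable_Omega_M assms) auto
  moreover have "(\<lambda>x. fst (snd (f x))) \<in> N \<rightarrow>\<^sub>M Ups_M"
    using s(2) by (intro measurable_Ups_M assms) auto
  moreover have "(\<lambda>x. zz (f x)) \<in> N \<rightarrow>\<^sub>M S_M \<beta>"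
    unfolding S_M_def using s(3) by (intro measurable_restrict_space2 assms) auto
  ultimately have "(\<lambda>x. (fst (f x), fst (snd (f x)), zz (f x))) \<in> N \<rightarrow>\<^sub>M Mb \<beta>"
    unfolding Mb_def by (intro measurable_Pair)
  then show ?thesis by simp
qed

lemma digit1_measurable [measurable]: "digit1 \<beta> \<in> Mb \<beta> \<rightarrow>\<^sub>M count_space UNIV"
proof -
  have "digit1 \<beta> = (\<lambda>p. if zz p \<in> E0 \<beta> then 0 else if zz p \<in> E1 \<beta> then 1
     else if zz p \<in> E2 \<beta> then 2 else if zz p \<in> C01 \<beta> then (if fst p 0 = 0 then 0 else 1)
     else if zz p \<in> C12 \<beta> then (if fst p 0 = 0 then 1 else 2)
     else if zz p \<in> C02 \<beta> then (if fst p 0 = 0 then 0 else 2)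
     else if zz p \<in> C012 \<beta> then fst (snd p) 0 else 0)"
    by (auto simp: fun_eq_iff digit1_def Kd_def)
  also have "\<dots> \<in> Mb \<beta> \<rightarrow>\<^sub>M count_space UNIV" by measurable
  finally show ?thesis .
qed

lemma Kb_measurable [measurable]: "Kb \<beta> \<in> Mb \<beta> \<rightarrow>\<^sub>M Mb \<beta>"
proof (rule measurable_Mb)
  have K: "Kb \<beta> p = (if zz p \<in> Cset \<beta> then sh (fst p) else fst p,
      if zz p \<in> C012 \<beta> then sh (fst (snd p)) else fst (snd p), \<beta> *\<^sub>R zz p - q (digit1 \<beta> p))"
    if "p \<in> space (Mb \<beta>)" for p
    using Kd_step(1)[of "fst p" "fst (snd p)" "zz p"] that by simp
  fix n
  have "(\<lambda>p. if zz p \<in> Cset \<beta> then fst p (Suc n) else fst p n) \<in> Mb \<beta> \<rightarrow>\<^sub>M count_space UNIV"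
    by measurable
  then show "(\<lambda>p. fst (Kb \<beta> p) n) \<in> Mb \<beta> \<rightarrow>\<^sub>M count_space UNIV"
    by (rule measurable_cong[THEN iffD1, rotated]) (simp add: K sh_def)
  have "(\<lambda>p. if zz p \<in> C012 \<beta> then fst (snd p) (Suc n) else fst (snd p) n) \<in> Mb \<beta> \<rightarrow>\<^sub>M count_space UNIV"
    by measurable
  then show "(\<lambda>p. fst (snd (Kb \<beta> p)) n) \<in> Mb \<beta> \<rightarrow>\<^sub>M count_space UNIV"
    by (rule measurable_cong[THEN iffD1, rotated]) (simp add: K sh_def)
  have "(\<lambda>p. \<beta> *\<^sub>R zz p - q (digit1 \<beta> p)) \<in> Mb \<beta> \<rightarrow>\<^sub>M borel"
    by (intro borel_measurable_diff borel_measurable_scaleR measurable_compose[OF digit1_measurable]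
        Mb_projections) auto
  then show "(\<lambda>p. zz (Kb \<beta> p)) \<in> Mb \<beta> \<rightarrow>\<^sub>M borel"
    by (rule measurable_cong[THEN iffD1, rotated]) (simp add: K)
qed (rule Kb_space)

lemma Kb_funpow_measurable [measurable]: "Kb \<beta> ^^ n \<in> Mb \<beta> \<rightarrow>\<^sub>M Mb \<beta>"
  by (rule measurable_compose_n[OF Kb_measurable])

lemma phib_component_measurable [measurable]: "(\<lambda>p. phib \<beta> p n) \<in> Mb \<beta> \<rightarrow>\<^sub>M count_space UNIV"
  unfolding phib_def by measurable

lemma phib_measurable: "phib \<beta> \<in> Mb \<beta> \<rightarrow>\<^sub>M Ups_M"
  using phib_Up by (intro measurable_Ups_M) auto

text \<open>Stated over an arbitrary source space so that it applies to \<open>Ups_M\<close> and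
  also to the sigma-algebras generated by the digits or by the codes of states.\<close>

lemma pib_measurable_gen:
  assumes [measurable]: "\<And>n. (\<lambda>x. f x n) \<in> N \<rightarrow>\<^sub>M count_space (UNIV :: nat set)"
  shows "(\<lambda>x. pib (f x)) \<in> N \<rightarrow>\<^sub>M borel"
proof -
  have "(\<lambda>x. pi1 (f x)) \<in> borel_measurable N" "(\<lambda>x. pi2 (f x)) \<in> borel_measurable N"
    unfolding pi1_def pi2_def by measurable
  then show ?thesis unfolding pib_def by (rule borel_measurable_Pair)
qed

lemma pib_sh_measurable [measurable]: "(\<lambda>b. pib ((sh ^^ n) b)) \<in> Ups_M \<rightarrow>\<^sub>M borel"
  by (rule pib_measurable_gen) (simp add: sh_funpow)

lemma visits_measurable [measurable]:
  assumes [measurable]: "\<And>n. Measurable.pred N (\<lambda>x. V x n)"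
  shows "(\<lambda>x. visits (V x) n) \<in> N \<rightarrow>\<^sub>M count_space UNIV"
proof (induction n)
  case (Suc n)
  have "(\<lambda>x. Suc (visits (V x) n)) \<in> N \<rightarrow>\<^sub>M count_space UNIV"
    by (rule measurable_compose[OF Suc.IH]) simp
  from measurable_If[OF this Suc.IH assms[unfolded pred_def]] show ?case by simp
qed simp

lemma vis_measurable [measurable]:
  "Measurable.pred Ups_M (\<lambda>b. visC b n)" "Measurable.pred Ups_M (\<lambda>b. visC012 b n)"
  unfolding visC_def visC012_def by measurable

lemma choice_measurable [measurable]:
  "(\<lambda>b. choice (pib ((sh ^^ n) b)) (b n)) \<in> Ups_M \<rightarrow>\<^sub>M count_space UNIV"
  unfolding choice_def by measurable

lemma psi_measurable: "psi \<in> Ups_M \<rightarrow>\<^sub>M Mb \<beta>"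
proof (rule measurable_Mb)
  show "(\<lambda>b. fst (psi b) k) \<in> Ups_M \<rightarrow>\<^sub>M count_space UNIV" for k
    unfolding psi_def psiw_def fst_conv by measurable
  show "(\<lambda>b. fst (snd (psi b)) k) \<in> Ups_M \<rightarrow>\<^sub>M count_space UNIV" for k
    unfolding psi_def psiu_def fst_conv snd_conv by measurable
  show "(\<lambda>b. zz (psi b)) \<in> Ups_M \<rightarrow>\<^sub>M borel"
    unfolding psi_def snd_conv by (rule pib_measurable_gen) measurable
qed (rule psi_space)

lemma Zs_sets: "Zs \<in> sets Ups_M"
proof -
  have "{b \<in> space Ups_M. (\<exists>\<^sub>\<infinity>n. visC b n) \<and> (\<exists>\<^sub>\<infinity>n. visC012 b n)} \<in> sets Ups_M"
    unfolding INFM_nat by measurable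
  then show ?thesis by (simp add: Zs_def space_Ups_M)
qed

end

section \<open>The Bernoulli measure\<close>

interpretation ups: sequence_space "uniform_count_measure {0, 1, 2 :: nat}"
  by (intro sequence_space.intro product_prob_spaceI prob_space_uniform_count_measure) auto

lemma prob_space_Pups: "prob_space Pups"
  using ups.P.prob_space_axioms by (simp add: Pups_def)

interpretation Pups: prob_space Pups by (rule prob_space_Pups)

lemma Pups_component [measurable]: "(\<lambda>u. u n) \<in> Pups \<rightarrow>\<^sub>M count_space UNIV"
  using Ups_M_component measurable_cong_sets[OF sets_Pups refl] by blast

lemma word_eq_nth: "map b [0..<length v] = v \<longleftrightarrow> (\<forall>i<length v. b i = v ! i)"
proof -
  have "map b [0..<length v] = v \<longleftrightarrow> map b [0..<length v] = map ((!) v) [0..<length v]"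
    by (simp only: map_nth)
  also have "\<dots> \<longleftrightarrow> (\<forall>i<length v. b i = v ! i)"
    by (simp only: map_eq_conv set_upt Ball_def atLeastLessThan_iff le0 simp_thms)
  finally show ?thesis .
qed

lemma measure_Pups_word:
  assumes "set v \<subseteq> {0, 1, 2}"
  shows "measure Pups {b \<in> space Pups. map b [0..<length v] = v} = (1 / 3) ^ length v"
proof -
  let ?X = "\<lambda>i. {v ! i}" and ?M = "\<lambda>_::nat. uniform_count_measure {0, 1, 2 :: nat}"
  have v: "v ! i \<in> {0, 1, 2}" if "i < length v" for i
    using assms nth_mem[OF that] by blast
  have "{b \<in> space Pups. map b [0..<length v] = v} = prod_emb UNIV ?M {..<length v} (Pi\<^sub>E {..<length v} ?X)"
    unfolding word_eq_nth prod_emb_def Pups_def space_PiM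
    by (auto simp: PiE_iff)
  moreover have "measure Pups (prod_emb UNIV ?M {..<length v} (Pi\<^sub>E {..<length v} ?X))
      = (\<Prod>i<length v. measure (?M i) (?X i))"
  proof -
    have "{v ! i} \<in> sets (uniform_count_measure {0, 1, 2})" if "i \<in> {..<length v}" for i
    proof -
      have "{v ! i} \<subseteq> {0, 1, 2}" using v[of i] that by simp
      then show ?thesis unfolding sets_uniform_count_measure by (rule PowI)
    qed
    from ups.measure_PiM_emb[of "{..<length v}" ?X, OF subset_UNIV finite_lessThan this]
    show ?thesis unfolding Pups_def .
  qed
  moreover have "measure (?M i) (?X i) = 1 / 3" if "i < length v" for i
    using v[OF that] by (subst measure_uniform_count_measure) simp_all
  then have "(\<Prod>i<length v. measure (?M i) (?X i)) = (\<Prod>i<length v. 1 / 3)"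
    by (intro prod.cong) simp_all
  ultimately show ?thesis by simp
qed

text \<open>Finite-dimensional boxes determine the product measure, and each box is a finite
  disjoint union of word cylinders of one length.\<close>

lemma Pups_eqI:
  assumes "prob_space N" and sets: "sets N = sets Ups_M"
    and words: "\<And>v. set v \<subseteq> {0, 1, 2} \<Longrightarrow>
      measure N {b \<in> space N. map b [0..<length v] = v} = (1 / 3) ^ length v"
  shows "N = Pups"
  unfolding Pups_def
proof (rule measure_eqI_PiM_infinite[symmetric, OF refl])
  interpret N: prob_space N by fact
  let ?M = "\<lambda>_::nat. uniform_count_measure {0, 1, 2 :: nat}"
  show "sets N = sets (Pi\<^sub>M UNIV ?M)" using sets sets_Pups by (simp add: Pups_def)
  have spN: "space N = space Pups" using sets sets_Pups sets_eq_imp_space_eq by metis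
  show "finite_measure (Pi\<^sub>M UNIV ?M)" using Pups.finite_measure_axioms by (simp add: Pups_def)
  fix A :: "nat \<Rightarrow> nat set" and J :: "nat set"
  assume J: "finite J" and A: "\<And>i. i \<in> J \<Longrightarrow> A i \<in> sets (?M i)"
  \<comment> \<open>Words of length \<open>n\<close> see all coordinates in \<open>J\<close>, so the
    box is decided by them.\<close>
  obtain n where n: "J \<subseteq> {..<n}" using J finite_nat_bounded by blast
  define W where "W = {v. set v \<subseteq> {0, 1, 2 :: nat} \<and> length v = n \<and> (\<forall>j\<in>J. v ! j \<in> A j)}"
  have finW: "finite W"
    unfolding W_def by (rule finite_subset[OF _ finite_lists_length_eq[of "{0, 1, 2}" n]]) auto
  let ?c = "\<lambda>v. {b \<in> space Pups. map b [0..<length v] = v}"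
  have eq: "prod_emb UNIV ?M J (Pi\<^sub>E J A) = (\<Union>v\<in>W. ?c v)"
  proof safe
    fix b assume b: "b \<in> prod_emb UNIV ?M J (Pi\<^sub>E J A)"
    then have sb: "b \<in> space Pups" and "\<forall>j\<in>J. b j \<in> A j"
      by (auto simp: prod_emb_def Pups_def space_PiM PiE_iff)
    moreover have "b i \<in> {0, 1, 2}" for i using sb by (simp add: space_Pups)
    then have "set (map b [0..<n]) \<subseteq> {0, 1, 2}" unfolding set_map by (rule image_subsetI)
    ultimately have "map b [0..<n] \<in> W" using n by (auto simp: W_def subset_iff simp del: set_map)
    with sb show "b \<in> (\<Union>v\<in>W. ?c v)"
      by (intro UN_I[of "map b [0..<n]"]) auto
  next
    fix v b assume v: "v \<in> W" and b: "b \<in> space Pups" "map b [0..<length v] = v"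
    have "b j \<in> A j" if "j \<in> J" for j
    proof -
      have "j < length v" using v n that by (auto simp: W_def)
      then have "v ! j = b j" using b(2) by (metis add_0 diff_zero length_upt nth_map nth_upt)
      then show ?thesis using v that by (auto simp: W_def)
    qed
    then show "b \<in> prod_emb UNIV ?M J (Pi\<^sub>E J A)"
      using b(1) by (auto simp: prod_emb_def Pups_def space_PiM)
  qed
  have cs: "?c v \<in> sets Pups" for v
  proof -
    have "?c v = {b \<in> space Pups. \<forall>i\<in>{..<length v}. b i = v ! i}"
      unfolding word_eq_nth by auto
    then show ?thesis by simp
  qed
  have dis: "disjoint_family_on ?c W" by (auto simp: disjoint_family_on_def W_def)
  have "measure Q (\<Union>v\<in>W. ?c v) = (\<Sum>v\<in>W. (1 / 3) ^ length v)"
    if "finite_measure Q" "sets Q = sets Pups"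
      "\<And>v. set v \<subseteq> {0, 1, 2} \<Longrightarrow> measure Q (?c v) = (1 / 3) ^ length v" for Q
  proof -
    interpret Q: finite_measure Q by fact
    have "?c ` W \<subseteq> sets Q" unfolding that(2) using cs by (rule image_subsetI)
    from Q.finite_measure_finite_Union[OF finW this dis]
    have "measure Q (\<Union>v\<in>W. ?c v) = (\<Sum>v\<in>W. measure Q (?c v))" .
    also have "\<dots> = (\<Sum>v\<in>W. (1 / 3) ^ length v)"
      by (rule sum.cong[OF refl that(3)]) (simp add: W_def)
    finally show ?thesis .
  qed
  from this[OF N.finite_measure_axioms] this[OF Pups.finite_measure_axioms refl measure_Pups_word]
  have "measure N (\<Union>v\<in>W. ?c v) = measure Pups (\<Union>v\<in>W. ?c v)"
    using sets sets_Pups words spN by simp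
  then have "emeasure Pups (\<Union>v\<in>W. ?c v) = emeasure N (\<Union>v\<in>W. ?c v)"
    by (simp add: N.emeasure_eq_measure Pups.emeasure_eq_measure)
  then show "emeasure (Pi\<^sub>M UNIV ?M) (prod_emb UNIV ?M J (Pi\<^sub>E J A)) = emeasure N (prod_emb UNIV ?M J (Pi\<^sub>E J A))"
    unfolding eq by (simp add: Pups_def)
qed

lemma sh_measurable [measurable]: "sh \<in> Pups \<rightarrow>\<^sub>M Pups"
proof -
  have "sh \<in> Pups \<rightarrow>\<^sub>M Ups_M"
    by (rule measurable_Ups_M) (auto simp: sh_def space_Pups)
  then show ?thesis using measurable_cong_sets[OF refl sets_Pups] by blast
qed

lemma distr_sh: "distr Pups Pups sh = Pups"
proof -
  have "distr ups.S ups.S (\<lambda>\<omega>. \<lambda>n\<in>UNIV. \<omega> (Suc n)) = ups.S"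
    by (rule distr_PiM_reindex) (auto simp: prob_space_uniform_count_measure)
  then show ?thesis by (simp add: Pups_def sh_def[abs_def] restrict_def)
qed

interpretation Pups: measure_preserving Pups sh
  by unfold_locales (rule sh_measurable, rule distr_sh)

lemma word_sets:
  "{b \<in> space Pups. map ((sh ^^ n) b) [0..<m] = v} \<in> sets Pups"
proof -
  have "{b \<in> space Pups. map ((sh ^^ n) b) [0..<m] = v}
      = {b \<in> space Pups. length v = m \<and> (\<forall>i\<in>{..<m}. b (i + n) = v ! i)}"
    using word_eq_nth[of "(sh ^^ n) _" v] by (auto simp: sh_funpow)
  then show ?thesis by simp
qed

text \<open>With \<open>V\<close> the set of sequences avoiding the word at all positions \<open>0, m, 2m, \<dots>\<close>, independence
  of the first block from the rest gives \<open>P V = (1 - 3\<^sup>-\<^sup>m) * P V\<close>.\<close>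
lemma AE_word_infinitely_often:
  assumes v: "set v \<subseteq> {0, 1, 2}" "v \<noteq> []"
  shows "AE b in Pups. \<exists>\<^sub>\<infinity>n. map ((sh ^^ n) b) [0..<length v] = v"
proof -
  define m where "m = length v"
  have m: "m > 0" using v by (simp add: m_def)
  define hit where "hit b n \<longleftrightarrow> map ((sh ^^ n) b) [0..<m] = v" for b n
  have [measurable]: "Measurable.pred Pups (\<lambda>b. hit b n)" for n
    unfolding hit_def pred_def by (rule word_sets)
  define V where "V = {b \<in> space Pups. \<forall>j. \<not> hit b (j * m)}"
  have V: "V \<in> sets Pups" unfolding V_def by measurable
  define W where "W = {b \<in> space Pups. \<not> hit b 0}"
  have W: "W \<in> sets Pups" unfolding W_def by measurable
  \<comment> \<open>\<open>comb_seq m x y\<close> takes its first \<open>m\<close> symbols from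
    \<open>x\<close> and continues with \<open>y\<close>; at multiples of \<open>m\<close>, every
    later block lies entirely inside \<open>y\<close>.\<close>
  have comb: "comb_seq m x y \<in> V \<longleftrightarrow> x \<in> W \<and> y \<in> V" if xy: "x \<in> space Pups" "y \<in> space Pups" for x y
  proof -
    have "comb_seq m x y \<in> space Pups"
      using xy by (auto simp: space_Pups comb_seq_def)
    moreover have "hit (comb_seq m x y) 0 \<longleftrightarrow> hit x 0"
    proof -
      have "map (comb_seq m x y) [0..<m] = map x [0..<m]" by (simp add: comb_seq_def)
      then show ?thesis by (simp only: hit_def funpow_0)
    qed
    moreover have "hit (comb_seq m x y) (Suc j * m) \<longleftrightarrow> hit y (j * m)" for j
    proof -
      have "(sh ^^ (Suc j * m)) (comb_seq m x y) i = (sh ^^ (j * m)) y i" for i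
        by (simp add: sh_funpow comb_seq_def)
      then show ?thesis unfolding hit_def by presburger
    qed
    moreover have "(\<forall>j. \<not> hit b (j * m)) \<longleftrightarrow> \<not> hit b 0 \<and> (\<forall>j. \<not> hit b (Suc j * m))" for b
      by (metis mult_0 not0_implies_Suc)
    ultimately show ?thesis
      using xy unfolding V_def W_def by simp
  qed
  have "emeasure Pups V = emeasure (distr (Pups \<Otimes>\<^sub>M Pups) Pups (\<lambda>(x, y). comb_seq m x y)) V"
    using ups.PiM_comb_seq[of m] by (simp add: Pups_def)
  also have "\<dots> = emeasure (Pups \<Otimes>\<^sub>M Pups) ((\<lambda>(x, y). comb_seq m x y) -` V \<inter> space (Pups \<Otimes>\<^sub>M Pups))"
    using measurable_comb_seq[of m "uniform_count_measure {0, 1, 2 :: nat}"] V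
    by (intro emeasure_distr) (simp_all add: Pups_def)
  also have "(\<lambda>(x, y). comb_seq m x y) -` V \<inter> space (Pups \<Otimes>\<^sub>M Pups) = W \<times> V"
    using comb W V sets.sets_into_space by (fastforce simp: space_pair_measure)
  also have "emeasure (Pups \<Otimes>\<^sub>M Pups) (W \<times> V) = emeasure Pups W * emeasure Pups V"
    by (rule Pups.emeasure_pair_measure_Times[OF W V])
  finally have "measure Pups V = measure Pups W * measure Pups V"
    by (simp add: Pups.emeasure_eq_measure flip: ennreal_mult)
  moreover have "measure Pups W = 1 - (1 / 3) ^ m"
  proof -
    have "{b \<in> space Pups. hit b 0} \<in> sets Pups" by measurable
    then have "measure Pups (space Pups - {b \<in> space Pups. hit b 0}) = 1 - (1 / 3) ^ m"
      using measure_Pups_word[OF v(1)] by (simp add: Pups.prob_compl hit_def m_def)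
    moreover have "space Pups - {b \<in> space Pups. hit b 0} = W" by (auto simp: W_def)
    ultimately show ?thesis by simp
  qed
  ultimately have "measure Pups V = 0" by (simp add: algebra_simps)
  then have VN: "V \<in> null_sets Pups" using V by (simp add: null_sets_def Pups.emeasure_eq_measure)
  \<comment> \<open>Starting the search later costs nothing: the null set \<open>V\<close> is pulled
    back under the measure-preserving shift by \<open>N * m\<close>, which is at least
    \<open>N\<close>.\<close>
  have "AE b in Pups. \<exists>n\<ge>N. hit b n" for N
  proof -
    let ?s = "sh ^^ (N * m)"
    have "?s -` V \<inter> space Pups \<in> null_sets Pups"
    proof -
      have "emeasure Pups (?s -` V \<inter> space Pups) = emeasure (distr Pups Pups ?s) V"
        by (rule emeasure_distr[OF Pups.funpow_meas V, symmetric])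
      also have "\<dots> = 0" using VN by (simp add: Pups.funpow_distr null_sets_def)
      finally show ?thesis using measurable_sets[OF Pups.funpow_meas V] by (simp add: null_sets_def)
    qed
    then show ?thesis
    proof (rule AE_I', intro subsetI)
      fix b assume "b \<in> {b \<in> space Pups. \<not> (\<exists>n\<ge>N. hit b n)}"
      then have b: "b \<in> space Pups" "\<And>n. N \<le> n \<Longrightarrow> \<not> hit b n" by auto
      have "\<not> hit (?s b) (j * m)" for j
      proof -
        have "(sh ^^ (j * m)) (?s b) = (sh ^^ ((j + N) * m)) b"
          by (simp add: fun_eq_iff sh_funpow algebra_simps)
        moreover have "N \<le> (j + N) * m" using m by (cases m) auto
        ultimately show ?thesis using b(2) unfolding hit_def by presburger
      qed
      then show "b \<in> ?s -` V \<inter> space Pups"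
        using b(1) Pups.funpow_space by (auto simp: V_def)
    qed
  qed
  then have "AE b in Pups. \<forall>N. \<exists>n\<ge>N. hit b n" by (simp add: AE_all_countable)
  then show ?thesis by (simp add: INFM_nat_le hit_def m_def)
qed

section \<open>Almost sure visits to the switch regions, and the measure \<open>nub\<close>\<close>

context random_beta
begin

text \<open>A long prefix of an expansion of \<open>z\<close> confines the point to the box around
  \<open>z\<close>, and almost every sequence contains this prefix infinitely often.\<close>

lemma AE_visits_box:
  assumes z: "z \<in> Sb \<beta>" and e: "0 < e"
    and R: "\<And>z'. z' \<in> Sb \<beta> \<Longrightarrow> \<bar>fst z' - fst z\<bar> < e \<Longrightarrow> \<bar>snd z' - snd z\<bar> < e \<Longrightarrow> z' \<in> R"
  shows "AE b in Pups. \<exists>\<^sub>\<infinity>n. pib ((sh ^^ n) b) \<in> R"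
proof -
  \<comment> \<open>Any coin sequences will do; the orbit over \<open>z\<close> provides a digit
    expansion of \<open>z\<close>.\<close>
  let ?p = "(\<lambda>_. 0, \<lambda>_. 0, z) :: state"
  have p: "?p \<in> space (Mb \<beta>)" using z by (simp add: space_Mb)
  define b0 where "b0 = phib \<beta> ?p"
  have b0: "b0 \<in> Up" "pib b0 = z"
    using phib_Up[OF p] zz_eq_pib[OF p] by (simp_all add: b0_def)
  have "(\<lambda>N. (1 / (\<beta> - 1)) / \<beta> ^ N) \<longlonglongrightarrow> 0"
    by (rule LIMSEQ_divide_realpow_zero[OF beta_gt1])
  then have "\<forall>\<^sub>F N in sequentially. (1 / (\<beta> - 1)) / \<beta> ^ N < e"
    using e by (rule order_tendstoD(2))
  \<comment> \<open>\<open>Suc N\<close> makes the word nonempty, as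
    \<open>AE_word_infinitely_often\<close> requires.\<close>
  then obtain N where N: "(1 / (\<beta> - 1)) / \<beta> ^ Suc N < e"
    unfolding eventually_sequentially by (meson Suc_n_not_le_n nat_le_linear)
  define v where "v = map b0 [0..<Suc N]"
  have "b0 i \<in> {0, 1, 2}" for i using b0(1) by simp
  then have v: "set v \<subseteq> {0, 1, 2}" unfolding v_def set_map by (rule image_subsetI)
  have v': "v \<noteq> []" by (simp add: v_def)
  have hit: "pib b \<in> R" if b: "b \<in> Up" and bv: "map b [0..<length v] = v" for b
  proof -
    have agree: "b i = b0 i" if "i < Suc N" for i
      using bv that by (simp add: v_def del: upt_Suc)
    let ?f = "\<lambda>n. pib ((sh ^^ n) b)" and ?g = "\<lambda>n. pib ((sh ^^ n) b0)"
    have "?f (Suc n) - ?g (Suc n) = \<beta> *\<^sub>R (?f n - ?g n)" if "n < Suc N" for n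
      using pib_sh[OF sh_funpow_Up[OF b, of n]] pib_sh[OF sh_funpow_Up[OF b0(1), of n]] agree[OF that]
      by (simp add: sh_funpow scaleR_diff_right)
    from expansion_distance[of ?f ?g "Suc N", OF pib_Sb pib_Sb this]
    show ?thesis using N R[OF pib_Sb] b0(2) by fastforce
  qed
  show ?thesis
    using AE_word_infinitely_often[OF v v'] AE_space
  proof eventually_elim
    case (elim b)
    then have "b \<in> Up" by (simp add: space_Pups)
    then show ?case
      using elim(1) hit[OF sh_funpow_Up] by (elim INFM_mono) blast
  qed
qed

lemma AE_Zs: "AE b in Pups. b \<in> Zs"
proof -
  define s where "s = 1 / (\<beta> - 1)"
  have s: "2 < s" using s_gt2 by (simp add: s_def)
  have sc: "\<beta> * (x / \<beta>) = x" for x using beta_pos by simp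
  \<comment> \<open>One of the three parts of \<open>Cset\<close> is enough. In scaled coordinates
    the box around \<open>(3/2, 1/4)\<close> of radius \<open>1/10\<close> has \<open>X > 1\<close>,
    \<open>Y < 1\<close> and \<open>X + Y < 2 < s\<close>.\<close>
  have c01: "AE b in Pups. \<exists>\<^sub>\<infinity>n. pib ((sh ^^ n) b) \<in> C01 \<beta>"
  proof (rule AE_visits_box[where z = "((3 / 2) / \<beta>, (1 / 4) / \<beta>)" and e = "(1 / 10) / \<beta>"])
    show "((3 / 2) / \<beta>, (1 / 4) / \<beta>) \<in> Sb \<beta>"
      unfolding Sb_iff sc s_def[symmetric] using s by simp
    fix z :: "real \<times> real" assume z: "z \<in> Sb \<beta>" "\<bar>fst z - fst ((3 / 2) / \<beta>, (1 / 4) / \<beta>)\<bar> < (1 / 10) / \<beta>"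
      "\<bar>snd z - snd ((3 / 2) / \<beta>, (1 / 4) / \<beta>)\<bar> < (1 / 10) / \<beta>"
    obtain x y where xy: "z = (x, y)" by force
    have "\<beta> * \<bar>x - (3 / 2) / \<beta>\<bar> < 1 / 10" "\<beta> * \<bar>y - (1 / 4) / \<beta>\<bar> < 1 / 10"
      using z(2,3) beta_pos by (simp_all add: xy pos_less_divide_eq mult.commute)
    then have "\<bar>\<beta> * x - 3 / 2\<bar> < 1 / 10" "\<bar>\<beta> * y - 1 / 4\<bar> < 1 / 10"
      using beta_pos by (simp_all add: abs_mult_pos' right_diff_distrib sc)
    then have "1 \<le> \<beta> * x" "\<beta> * y < 1" "\<beta> * x + \<beta> * y \<le> s"
      using s unfolding abs_less_iff by linarith+
    then show "z \<in> C01 \<beta>"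
      using z(1) unfolding xy by (simp add: region_iff s_def[symmetric])
  qed (use beta_pos in simp)
  have c012: "AE b in Pups. \<exists>\<^sub>\<infinity>n. pib ((sh ^^ n) b) \<in> C012 \<beta>"
  proof -
    \<comment> \<open>The scaled box around \<open>(1 + h, 1 + h)\<close> of radius \<open>h\<close>
      has \<open>X > 1\<close>, \<open>Y > 1\<close> and \<open>X + Y < 2 + 4 * h\<close>, which
      equals \<open>s\<close> for this \<open>h\<close>.\<close>
    define h where "h = (s - 2) / 4"
    have h: "0 < h" "2 + 4 * h = s" using s by (simp_all add: h_def field_simps)
    show ?thesis
    proof (rule AE_visits_box[where z = "((1 + h) / \<beta>, (1 + h) / \<beta>)" and e = "h / \<beta>"])
      show "((1 + h) / \<beta>, (1 + h) / \<beta>) \<in> Sb \<beta>"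
        unfolding Sb_iff sc s_def[symmetric] using h by simp
      fix z :: "real \<times> real" assume z: "z \<in> Sb \<beta>" "\<bar>fst z - fst ((1 + h) / \<beta>, (1 + h) / \<beta>)\<bar> < h / \<beta>"
        "\<bar>snd z - snd ((1 + h) / \<beta>, (1 + h) / \<beta>)\<bar> < h / \<beta>"
      obtain x y where xy: "z = (x, y)" by force
      have "\<beta> * \<bar>x - (1 + h) / \<beta>\<bar> < h" "\<beta> * \<bar>y - (1 + h) / \<beta>\<bar> < h"
        using z(2,3) beta_pos by (simp_all add: xy pos_less_divide_eq mult.commute)
      then have "\<bar>\<beta> * x - (1 + h)\<bar> < h" "\<bar>\<beta> * y - (1 + h)\<bar> < h"
        using beta_pos by (simp_all add: abs_mult_pos' right_diff_distrib sc)
      then have "1 \<le> \<beta> * x" "1 \<le> \<beta> * y" "\<beta> * x + \<beta> * y \<le> s"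
        using h unfolding abs_less_iff by linarith+
      then show "z \<in> C012 \<beta>"
        using z(1) unfolding xy by (simp add: region_iff s_def[symmetric])
    qed (use beta_pos h in simp)
  qed
  show ?thesis
    using c01 c012 AE_space
  proof eventually_elim
    case (elim b)
    have "\<exists>\<^sub>\<infinity>n. visC b n" using elim(1) by (rule INFM_mono) (simp add: visC_def Cset_def)
    then show ?case using elim by (simp add: Zs_def visC012_def space_Pups)
  qed
qed

lemma psi_Pups [measurable]: "psi \<in> Pups \<rightarrow>\<^sub>M Mb \<beta>"
  using psi_measurable measurable_cong_sets[OF sets_Pups refl] by blast

lemma phib_Pups [measurable]: "phib \<beta> \<in> Mb \<beta> \<rightarrow>\<^sub>M Pups"
  using phib_measurable measurable_cong_sets[OF refl sets_Pups] by blast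

lemma phib_image_sets:
  assumes "A \<in> sets (Mb \<beta>)"
  shows "phib \<beta> ` (Zb \<beta> \<inter> A) \<in> sets Pups"
proof -
  have "phib \<beta> ` (Zb \<beta> \<inter> A) = Zs \<inter> (psi -` A \<inter> space Pups)"
    unfolding phib_image[OF sets.sets_into_space[OF assms]] by (auto simp: Zs_def space_Pups)
  also have "\<dots> \<in> sets Pups"
    using Zs_sets measurable_sets[OF psi_Pups assms] sets_Pups by auto
  finally show ?thesis .
qed

text \<open>A measure projecting to \<open>Pups\<close> is carried by \<open>Zb\<close>, where \<open>phib\<close> is injective.\<close>
lemma emeasure_eq_image:
  assumes sets: "sets \<mu> = sets (Mb \<beta>)" and d: "distr \<mu> Pups (phib \<beta>) = Pups" and A: "A \<in> sets (Mb \<beta>)"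
  shows "emeasure \<mu> A = emeasure Pups (phib \<beta> ` (Zb \<beta> \<inter> A))"
proof -
  have sp: "space \<mu> = space (Mb \<beta>)" using sets by (rule sets_eq_imp_space_eq)
  have m: "phib \<beta> \<in> \<mu> \<rightarrow>\<^sub>M Pups" using phib_Pups measurable_cong_sets[OF sets refl] by blast
  have "AE b in distr \<mu> Pups (phib \<beta>). b \<in> Zs" unfolding d by (rule AE_Zs)
  then have AE: "AE p in \<mu>. phib \<beta> p \<in> Zs" by (rule AE_distrD[OF m])
  let ?I = "phib \<beta> ` (Zb \<beta> \<inter> A)"
  have I: "?I = {b \<in> Zs. psi b \<in> A}" by (rule phib_image[OF sets.sets_into_space[OF A]])
  have "emeasure Pups ?I = emeasure (distr \<mu> Pups (phib \<beta>)) ?I" by (simp add: d)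
  also have "\<dots> = emeasure \<mu> (phib \<beta> -` ?I \<inter> space \<mu>)"
    by (rule emeasure_distr[OF m phib_image_sets[OF A]])
  also have "\<dots> = emeasure \<mu> A"
  proof (rule emeasure_eq_AE)
    show "AE p in \<mu>. (p \<in> phib \<beta> -` ?I \<inter> space \<mu>) = (p \<in> A)"
      using AE AE_space by eventually_elim (auto simp: I sp psi_phib)
    show "phib \<beta> -` ?I \<inter> space \<mu> \<in> sets \<mu>" by (rule measurable_sets[OF m phib_image_sets[OF A]])
    show "A \<in> sets \<mu>" using A sets by simp
  qed
  finally show ?thesis by simp
qed

lemma distr_psi_phib: "distr (distr Pups (Mb \<beta>) psi) Pups (phib \<beta>) = Pups"
proof -
  have "distr (distr Pups (Mb \<beta>) psi) Pups (phib \<beta>) = distr Pups Pups (phib \<beta> \<circ> psi)"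
    by (rule distr_distr) measurable
  also have "\<dots> = distr Pups Pups (\<lambda>b. b)"
    by (rule distr_cong) (auto simp: space_Pups phib_psi)
  finally show ?thesis by simp
qed

text \<open>The set function defining \<open>nub\<close> agrees on measurable sets with a
  push-forward of \<open>Pups\<close>, so countable additivity comes for free.\<close>

lemma nub_eq_distr: "nub \<beta> = distr Pups (Mb \<beta>) psi"
proof -
  let ?N = "distr Pups (Mb \<beta>) psi"
  have "nub \<beta> = measure_of (space ?N) (sets ?N) (emeasure ?N)"
    unfolding nub_def
    by (simp, rule measure_of_eq[OF sets.space_closed])
       (simp add: emeasure_eq_image[OF sets_distr distr_psi_phib] sets.sigma_sets_eq)
  then show ?thesis by (simp only: measure_of_of_measure)
qed

lemma emeasure_nub: "A \<in> sets (Mb \<beta>) \<Longrightarrow> emeasure (nub \<beta>) A = emeasure Pups (phib \<beta> ` (Zb \<beta> \<inter> A))"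
  unfolding nub_eq_distr by (rule emeasure_eq_image[OF sets_distr distr_psi_phib])

lemma sets_nub: "sets (nub \<beta>) = sets (Mb \<beta>)"
  by (simp add: nub_eq_distr)

text \<open>By \<open>emeasure_eq_image\<close> the projection determines the measure. Both the
  invariance of \<open>nub\<close> and the uniqueness of the maximiser are reduced to this.\<close>

lemma nub_unique:
  assumes "sets \<mu> = sets (Mb \<beta>)" and "distr \<mu> Pups (phib \<beta>) = Pups"
  shows "\<mu> = nub \<beta>"
proof (rule measure_eqI)
  fix A assume "A \<in> sets \<mu>"
  then have "A \<in> sets (Mb \<beta>)" using assms(1) by simp
  then show "emeasure \<mu> A = emeasure (nub \<beta>) A"
    using emeasure_nub emeasure_eq_image[OF assms] by simp
qed (simp add: assms(1) sets_nub)

lemma distr_nub: "distr (nub \<beta>) Pups (phib \<beta>) = Pups"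
  unfolding nub_eq_distr by (rule distr_psi_phib)

text \<open>The image of \<open>nub\<close> under \<open>Kb\<close> projects to the shifted
  Bernoulli measure, which is again Bernoulli; \<open>nub_unique\<close> then identifies it with
  \<open>nub\<close>.\<close>

lemma invariant_nub: "invariant_prob (Mb \<beta>) (Kb \<beta>) (nub \<beta>)"
proof -
  have mK: "Kb \<beta> \<in> nub \<beta> \<rightarrow>\<^sub>M Mb \<beta>" and mphi: "phib \<beta> \<in> nub \<beta> \<rightarrow>\<^sub>M Pups"
    using Kb_measurable phib_Pups measurable_cong_sets[OF sets_nub refl] by blast+
  have "distr (distr (nub \<beta>) (Mb \<beta>) (Kb \<beta>)) Pups (phib \<beta>) = distr (nub \<beta>) Pups (phib \<beta> \<circ> Kb \<beta>)"
    by (rule distr_distr[OF phib_Pups mK])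
  also have "phib \<beta> \<circ> Kb \<beta> = sh \<circ> phib \<beta>" by (simp add: fun_eq_iff phib_Kb)
  also have "distr (nub \<beta>) Pups (sh \<circ> phib \<beta>) = distr (distr (nub \<beta>) Pups (phib \<beta>)) Pups sh"
    by (rule distr_distr[OF sh_measurable mphi, symmetric])
  also have "\<dots> = Pups" by (simp add: distr_nub distr_sh)
  finally have "distr (nub \<beta>) (Mb \<beta>) (Kb \<beta>) = nub \<beta>"
    by (intro nub_unique) simp_all
  moreover have "prob_space (nub \<beta>)"
    unfolding nub_eq_distr by (rule Pups.prob_space_distr) measurable
  ultimately show ?thesis by (simp add: invariant_prob_def sets_nub)
qed

end

section \<open>Entropy of invariant measures\<close>

context random_beta
begin

text \<open>Coins not consumed in the step are seen in the image, and a consumed one is read off the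
  digit. \<open>C01\<close> has to be listed besides \<open>Cset\<close> because digit 1 means coin
  1 there but coin 0 on \<open>C12\<close>.\<close>

lemma Kb_backward:
  assumes p: "p \<in> space (Mb \<beta>)" and p': "p' \<in> space (Mb \<beta>)" and d: "digit1 \<beta> p = digit1 \<beta> p'"
    and R: "\<And>R. R \<in> {Cset \<beta>, C012 \<beta>, C01 \<beta>} \<Longrightarrow> zz p \<in> R \<longleftrightarrow> zz p' \<in> R"
    and w: "\<And>k. k < L \<Longrightarrow> fst (Kb \<beta> p) k = fst (Kb \<beta> p') k"
    and u: "\<And>k. k < L \<Longrightarrow> fst (snd (Kb \<beta> p)) k = fst (snd (Kb \<beta> p')) k"
    and k: "k < L"
  shows "fst p k = fst p' k" and "fst (snd p) k = fst (snd p') k"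
proof -
  note s = Kd_step[of "fst p" "fst (snd p)" "zz p", simplified, OF p]
  note s' = Kd_step[of "fst p'" "fst (snd p')" "zz p'", simplified, OF p']
  have Rs: "zz p \<in> Cset \<beta> \<longleftrightarrow> zz p' \<in> Cset \<beta>" "zz p \<in> C012 \<beta> \<longleftrightarrow> zz p' \<in> C012 \<beta>"
    "zz p \<in> C01 \<beta> \<longleftrightarrow> zz p' \<in> C01 \<beta>" by (rule R, simp)+
  show "fst p k = fst p' k"
  proof (cases "zz p \<in> Cset \<beta>")
    case True
    then have True': "zz p' \<in> Cset \<beta>" using Rs by simp
    show ?thesis
    proof (cases k)
      case 0
      then show ?thesis using s(4)[OF True] s'(4)[OF True'] d Rs(3) by (simp add: choice_def)
    next
      case (Suc k')
      then show ?thesis using w[of k'] k s(1) s'(1) True True' by (simp add: sh_def)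
    qed
  next
    case False
    then show ?thesis using w[OF k] s(1) s'(1) Rs by simp
  qed
  show "fst (snd p) k = fst (snd p') k"
  proof (cases "zz p \<in> C012 \<beta>")
    case True
    then have True': "zz p' \<in> C012 \<beta>" using Rs by simp
    show ?thesis
    proof (cases k)
      case 0
      then show ?thesis using s(5)[OF True] s'(5)[OF True'] d by simp
    next
      case (Suc k')
      then show ?thesis using u[of k'] k s(1) s'(1) True True' by (simp add: sh_def)
    qed
  next
    case False
    then show ?thesis using u[OF k] s(1) s'(1) Rs by simp
  qed
qed

text \<open>Downward induction from time \<open>n\<close>: a backward step loses none of the known
  coordinates, so \<open>L\<close> of them at time \<open>n\<close> suffice for all earlier times,
  however large \<open>n\<close> is.\<close>

lemma funpow_backward:
  assumes p: "p \<in> space (Mb \<beta>)" and p': "p' \<in> space (Mb \<beta>)"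
    and d: "\<And>i. i < n \<Longrightarrow> phib \<beta> p i = phib \<beta> p' i"
    and R: "\<And>i R. i < n \<Longrightarrow> R \<in> {Cset \<beta>, C012 \<beta>, C01 \<beta>} \<Longrightarrow>
      zz ((Kb \<beta> ^^ i) p) \<in> R \<longleftrightarrow> zz ((Kb \<beta> ^^ i) p') \<in> R"
    and w: "\<And>k. k < L \<Longrightarrow> fst ((Kb \<beta> ^^ n) p) k = fst ((Kb \<beta> ^^ n) p') k"
    and u: "\<And>k. k < L \<Longrightarrow> fst (snd ((Kb \<beta> ^^ n) p)) k = fst (snd ((Kb \<beta> ^^ n) p')) k"
    and i: "i \<le> n"
  shows "\<forall>k<L. fst ((Kb \<beta> ^^ i) p) k = fst ((Kb \<beta> ^^ i) p') k \<and>
    fst (snd ((Kb \<beta> ^^ i) p)) k = fst (snd ((Kb \<beta> ^^ i) p')) k"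
  using i
proof (induction rule: inc_induct)
  case base
  then show ?case using w u by simp
next
  case (step m)
  have dm: "digit1 \<beta> ((Kb \<beta> ^^ m) p) = digit1 \<beta> ((Kb \<beta> ^^ m) p')"
    using d[OF step(2)] by (simp add: phib_def)
  have IH: "fst (Kb \<beta> ((Kb \<beta> ^^ m) p)) k = fst (Kb \<beta> ((Kb \<beta> ^^ m) p')) k"
    "fst (snd (Kb \<beta> ((Kb \<beta> ^^ m) p))) k = fst (snd (Kb \<beta> ((Kb \<beta> ^^ m) p'))) k" if "k < L" for k
    using step.IH that by simp_all
  show ?case
    using Kb_backward[OF Kb_funpow_space[OF p] Kb_funpow_space[OF p'] dm R[OF step(2)] IH]
    by (intro allI impI conjI)
qed

text \<open>The position is absent: it is the expansion of the full digit sequence, so these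
  discrete coordinates already generate the sigma-algebra of the state space.\<close>

definition code :: "nat \<Rightarrow> state \<Rightarrow> nat \<times> nat \<times> nat" where
  "code n p = (fst p n, fst (snd p) n, phib \<beta> p n)"

lemma measurable_sigma_count:
  fixes c :: "nat \<Rightarrow> 'a \<Rightarrow> 'b :: countable"
  shows "c n \<in> sigma S {c n -` {x} \<inter> S | n x. True} \<rightarrow>\<^sub>M count_space UNIV"
proof (subst measurable_count_space_eq2_countable, intro conjI ballI)
  have sub: "{c n -` {x} \<inter> S | n x. True} \<subseteq> Pow S" by auto
  fix a :: 'b
  have "c n -` {a} \<inter> S \<in> {c n -` {x} \<inter> S | n x. True}" by blast
  then show "c n -` {a} \<inter> space (sigma S {c n -` {x} \<inter> S | n x. True}) \<in> sets (sigma S {c n -` {x} \<inter> S | n x. True})"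
    using sub by (simp add: space_measure_of sets_measure_of sigma_sets.Basic)
qed auto

lemma sets_sigma_gen:
  "sets (sigma S {c n -` {x} \<inter> S | n x. True}) = sigma_sets S {c n -` {x} \<inter> S | n x. True}"
  "space (sigma S {c n -` {x} \<inter> S | n x. True}) = S"
  by (auto intro!: sets_measure_of space_measure_of)

text \<open>The position is a function of the digits alone. Regions can therefore be guessed without
  reference to the coins, which are the unknowns of the backward recovery.\<close>

lemma region_in_sigma_digits:
  assumes R: "R \<in> sets borel"
  shows "{p \<in> space (Mb \<beta>). zz p \<in> R} \<in> sigma_sets (space (Mb \<beta>)) {(\<lambda>p. phib \<beta> p n) -` {x} \<inter> space (Mb \<beta>) | n x. True}"
proof -
  let ?V = "sigma (space (Mb \<beta>)) {(\<lambda>p. phib \<beta> p n) -` {x} \<inter> space (Mb \<beta>) | n x. True}"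
  note sg = sets_sigma_gen[of "space (Mb \<beta>)" "\<lambda>n p. phib \<beta> p n"]
  have "(\<lambda>p. pib (phib \<beta> p)) \<in> ?V \<rightarrow>\<^sub>M borel"
    by (rule pib_measurable_gen) (rule measurable_sigma_count)
  from measurable_sets[OF this R]
  have "(\<lambda>p. pib (phib \<beta> p)) -` R \<inter> space (Mb \<beta>) \<in> sets ?V" unfolding sg(2) .
  moreover have "(\<lambda>p. pib (phib \<beta> p)) -` R \<inter> space (Mb \<beta>) = {p \<in> space (Mb \<beta>). zz p \<in> R}"
  proof (rule set_eqI)
    fix p
    show "p \<in> (\<lambda>p. pib (phib \<beta> p)) -` R \<inter> space (Mb \<beta>) \<longleftrightarrow> p \<in> {p \<in> space (Mb \<beta>). zz p \<in> R}"
      by (cases "p \<in> space (Mb \<beta>)") (simp_all add: zz_eq_pib)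
  qed
  ultimately show ?thesis unfolding sg(1) by simp
qed

lemma Mb_in_sigma_code:
  assumes A: "A \<in> sets (Mb \<beta>)"
  shows "A \<in> sigma_sets (space (Mb \<beta>)) {code n -` {x} \<inter> space (Mb \<beta>) | n x. True}"
proof -
  let ?V = "sigma (space (Mb \<beta>)) {code n -` {x} \<inter> space (Mb \<beta>) | n x. True}"
  note sg = sets_sigma_gen[of "space (Mb \<beta>)" code]
  have comp: "(\<lambda>p. f (code n p)) \<in> ?V \<rightarrow>\<^sub>M count_space UNIV" for f :: "_ \<Rightarrow> nat" and n
    by (rule measurable_compose[OF measurable_sigma_count]) simp
  have phi: "(\<lambda>p. phib \<beta> p n) \<in> ?V \<rightarrow>\<^sub>M count_space UNIV" for n
    using comp[of "\<lambda>x. snd (snd x)" n] by (simp add: code_def)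
  have "(\<lambda>p. p) \<in> ?V \<rightarrow>\<^sub>M Mb \<beta>"
  proof (rule measurable_Mb)
    show "(\<lambda>p. fst p n) \<in> ?V \<rightarrow>\<^sub>M count_space UNIV" for n
      using comp[of "\<lambda>x. fst x" n] by (simp add: code_def)
    show "(\<lambda>p. fst (snd p) n) \<in> ?V \<rightarrow>\<^sub>M count_space UNIV" for n
      using comp[of "\<lambda>x. fst (snd x)" n] by (simp add: code_def)
    have "(\<lambda>p. pib (phib \<beta> p)) \<in> ?V \<rightarrow>\<^sub>M borel" by (rule pib_measurable_gen) (rule phi)
    then show "(\<lambda>p. zz p) \<in> ?V \<rightarrow>\<^sub>M borel"
      by (rule measurable_cong[THEN iffD1, rotated]) (simp only: sg(2) zz_eq_pib)
  qed (simp only: sg(2))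
  from measurable_sets[OF this A] have "(\<lambda>p. p) -` A \<inter> space (Mb \<beta>) \<in> sets ?V" unfolding sg(2) .
  moreover have "(\<lambda>p. p) -` A \<inter> space (Mb \<beta>) = A" using sets.sets_into_space[OF A] by auto
  ultimately show ?thesis unfolding sg(1) by simp
qed

end

section \<open>Partition entropy against digit entropy for an invariant measure\<close>

locale invariant_random_beta = random_beta +
  fixes \<mu> :: "state measure"
  assumes invariant: "invariant_prob (Mb \<beta>) (Kb \<beta>) \<mu>"
begin

lemma sets_mu: "sets \<mu> = sets (Mb \<beta>)" using invariant by (simp add: invariant_prob_def)

lemma space_mu: "space \<mu> = space (Mb \<beta>)" using sets_mu by (rule sets_eq_imp_space_eq)

sublocale measure_preserving \<mu> "Kb \<beta>"
proof -
  have "prob_space \<mu>" "distr \<mu> (Mb \<beta>) (Kb \<beta>) = \<mu>" using invariant by (auto simp: invariant_prob_def)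
  moreover have "Kb \<beta> \<in> \<mu> \<rightarrow>\<^sub>M \<mu>" using Kb_measurable measurable_cong_sets[OF sets_mu sets_mu] by blast
  moreover have "distr \<mu> \<mu> (Kb \<beta>) = distr \<mu> (Mb \<beta>) (Kb \<beta>)" by (rule distr_cong) (simp_all add: sets_mu)
  ultimately show "measure_preserving \<mu> (Kb \<beta>)" by (simp add: measure_preserving_def measure_preserving_axioms_def)
qed

lemma simple_function_finite:
  assumes "f \<in> Mb \<beta> \<rightarrow>\<^sub>M count_space UNIV" "finite B" "\<And>p. p \<in> space (Mb \<beta>) \<Longrightarrow> f p \<in> B"
  shows "simple_function \<mu> f"
proof -
  have m: "f \<in> \<mu> \<rightarrow>\<^sub>M count_space UNIV" using assms(1) measurable_cong_sets[OF sets_mu refl] by blast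
  have "f ` space \<mu> \<subseteq> B" unfolding space_mu using assms(3) by (rule image_subsetI)
  then have "finite (f ` space \<mu>)" using assms(2) by (rule finite_subset)
  then show ?thesis using measurable_sets[OF m] by (simp add: simple_function_def)
qed

lemma simple_digit: "simple_function \<mu> (digit1 \<beta>)"
  by (rule simple_function_finite[OF digit1_measurable _ digit1_range]) simp

lemma digit_word_eq: "word (Kb \<beta>) (digit1 \<beta>) n p = map (phib \<beta> p) [0..<n]"
  by (simp add: word_def phib_def)

lemma digit_word_nth:
  "word (Kb \<beta>) (digit1 \<beta>) n p = word (Kb \<beta>) (digit1 \<beta>) n p' \<longleftrightarrow> (\<forall>i<n. phib \<beta> p i = phib \<beta> p' i)"
  by (auto simp: digit_word_eq)

text \<open>The coin data from which the backward recovery starts when evaluated at the final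
  time.\<close>

definition ends :: "nat \<Rightarrow> state \<Rightarrow> nat list \<times> nat list" where
  "ends L p = (map (fst p) [0..<L], map (fst (snd p)) [0..<L])"

lemma simple_ends: "simple_function \<mu> (ends L)"
proof -
  have "simple_function \<mu> (\<lambda>p. map (\<lambda>i. f p i) [0..<L])"
    if "\<And>n. (\<lambda>p. f p n) \<in> Mb \<beta> \<rightarrow>\<^sub>M count_space UNIV" "finite B"
      "\<And>p n. p \<in> space (Mb \<beta>) \<Longrightarrow> f p n \<in> B" for f :: "state \<Rightarrow> nat \<Rightarrow> nat" and B
  proof (induction L)
    case (Suc L)
    have s: "simple_function \<mu> (\<lambda>p. f p L)" using that by (intro simple_function_finite[of _ B]) auto
    show ?case
      by (rule fun_entropy_determined(1)[OF simple_function_Pair[OF Suc s]]) simp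
  qed simp
  from this[of "\<lambda>p n. fst p n" "{0, 1}"] this[of "\<lambda>p n. fst (snd p) n" "{0, 1, 2}"]
  have "simple_function \<mu> (\<lambda>p. map (fst p) [0..<L])" "simple_function \<mu> (\<lambda>p. map (fst (snd p)) [0..<L])"
    by (auto simp: space_Mb)
  then show ?thesis unfolding ends_def[abs_def] by (rule simple_function_Pair)
qed

text \<open>The digit word of length \<open>n + M\<close>, the error words and the first \<open>L\<close> coordinates of the
  \<open>\<Omega>\<close>- and \<open>\<Upsilon>\<close>-components at time \<open>n\<close> determine the itinerary of length \<open>n\<close>: the components are
  recovered backwards in time.\<close>
lemma entropy_rate_le_digit:
  assumes \<alpha>: "fin_part \<mu> \<alpha>" and e: "0 < e"
  shows "entropy_rate (\<lambda>p. {A \<in> \<alpha>. p \<in> A}) \<le> entropy_rate (digit1 \<beta>) + e"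
proof -
  let ?X = "\<lambda>p. {A \<in> \<alpha>. p \<in> A}" and ?D = "digit1 \<beta>" and ?K = "Kb \<beta>"
  let ?c = "\<lambda>L p. map (\<lambda>i. code i p) [0..<L]" and ?d = "\<lambda>L p. map (\<lambda>i. phib \<beta> p i) [0..<L]"
  define \<R> where "\<R> = {Cset \<beta>, C012 \<beta>, C01 \<beta>}"
  have fin: "finite \<alpha>" and sub: "\<And>A. A \<in> \<alpha> \<Longrightarrow> A \<in> sets (Mb \<beta>)"
    using \<alpha> sets_mu by (auto simp: fin_part_def)
  have X: "simple_function \<mu> ?X" by (rule ent_part_eq_rate(1)[OF \<alpha>])
  have e2: "0 < e / 2" using e by simp
  have code_meas: "code n \<in> Mb \<beta> \<rightarrow>\<^sub>M count_space UNIV" for n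
    unfolding code_def[abs_def] by measurable
  have genc: "{code n -` {x} \<inter> space \<mu> | n x. True} \<subseteq> sets \<mu>"
    using measurable_sets[OF code_meas] by (auto simp: space_mu sets_mu)
  have gend: "{(\<lambda>p. phib \<beta> p n) -` {x} \<inter> space \<mu> | n x. True} \<subseteq> sets \<mu>"
    using measurable_sets[OF phib_component_measurable] by (auto simp: space_mu sets_mu)
  from cylinder_approx_finite[OF genc fin, of "\<lambda>A. A", OF Mb_in_sigma_code[folded space_mu, OF sub] e2]
  obtain L where "\<forall>L'\<ge>L. \<exists>G. simple_function \<mu> (\<lambda>p. {A \<in> \<alpha>. (p \<in> A) \<noteq> G A (?c L' p)}) \<and>
     fun_entropy \<mu> (\<lambda>p. {A \<in> \<alpha>. (p \<in> A) \<noteq> G A (?c L' p)}) \<le> e / 2" ..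
  from this[rule_format, OF order_refl] obtain G where G: "simple_function \<mu> (\<lambda>p. {A \<in> \<alpha>. (p \<in> A) \<noteq> G A (?c L p)})"
     "fun_entropy \<mu> (\<lambda>p. {A \<in> \<alpha>. (p \<in> A) \<noteq> G A (?c L p)}) \<le> e / 2" by (elim exE conjE)
  have finR: "finite \<R>" by (simp add: \<R>_def)
  have Rs: "{p \<in> space (Mb \<beta>). zz p \<in> R} \<in> sigma_sets (space \<mu>) {(\<lambda>p. phib \<beta> p n) -` {x} \<inter> space \<mu> | n x. True}"
    if "R \<in> \<R>" for R
    unfolding space_mu using that by (intro region_in_sigma_digits) (auto simp: \<R>_def)
  from cylinder_approx_finite[OF gend finR, of "\<lambda>R. {p \<in> space (Mb \<beta>). zz p \<in> R}", OF Rs e2]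
  obtain M0 where "\<forall>M'\<ge>M0. \<exists>H. simple_function \<mu> (\<lambda>p. {R \<in> \<R>. (p \<in> {p \<in> space (Mb \<beta>). zz p \<in> R}) \<noteq> H R (?d M' p)}) \<and>
     fun_entropy \<mu> (\<lambda>p. {R \<in> \<R>. (p \<in> {p \<in> space (Mb \<beta>). zz p \<in> R}) \<noteq> H R (?d M' p)}) \<le> e / 2" ..
  from this[rule_format, OF le_add1[of M0 L]] obtain H where H: "simple_function \<mu> (\<lambda>p. {R \<in> \<R>. (p \<in> {p \<in> space (Mb \<beta>). zz p \<in> R}) \<noteq> H R (?d (M0 + L) p)})"
     "fun_entropy \<mu> (\<lambda>p. {R \<in> \<R>. (p \<in> {p \<in> space (Mb \<beta>). zz p \<in> R}) \<noteq> H R (?d (M0 + L) p)}) \<le> e / 2" by (elim exE conjE)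
  \<comment> \<open>\<open>M \<ge> L\<close>, so the digits before time \<open>n + M\<close> also
    supply the digit components of \<open>code k\<close>, \<open>k < L\<close>, at every time before
    \<open>n\<close>.\<close>
  define M where "M = M0 + L"
  let ?E1 = "\<lambda>p. {A \<in> \<alpha>. (p \<in> A) \<noteq> G A (?c L p)}"
  let ?E2 = "\<lambda>p. {R \<in> \<R>. (p \<in> {p \<in> space (Mb \<beta>). zz p \<in> R}) \<noteq> H R (?d M p)}"
  note H = H[folded M_def]
  let ?F = "\<lambda>n p. ends L ((?K ^^ n) p)"
  \<comment> \<open>The entropy budget: the digit word carries the main term, each error word costs
    at most \<open>n * (e / 2)\<close>, and the end block costs an amount independent of
    \<open>n\<close>.\<close>
  let ?B = "\<lambda>n p. (word ?K ?D (n + M) p, word ?K ?E1 n p, word ?K ?E2 n p, ?F n p)"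
  have det: "word ?K ?X n p = word ?K ?X n p'"
    if p: "p \<in> space \<mu>" and p': "p' \<in> space \<mu>" and B: "?B n p = ?B n p'" for n p p'
  proof -
    note pp = p[unfolded space_mu] p'[unfolded space_mu]
    have phi: "phib \<beta> p i = phib \<beta> p' i" if "i < n + M" for i
      using B that digit_word_nth by blast
    have E1: "?E1 ((?K ^^ i) p) = ?E1 ((?K ^^ i) p')" and E2: "?E2 ((?K ^^ i) p) = ?E2 ((?K ^^ i) p')"
      if "i < n" for i
      using B that by (simp_all only: prod.inject word_eq_iff)
    have dM: "?d m ((?K ^^ i) p) = ?d m ((?K ^^ i) p')" if "i < n" "m \<le> M" for i m
      using that by (auto simp: phib_funpow intro!: phi)
    \<comment> \<open>The guess \<open>H\<close> from the next \<open>M\<close> digits is the same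
      for both points, and equal error sets correct it in the same way.\<close>
    have reg: "zz ((?K ^^ i) p) \<in> R \<longleftrightarrow> zz ((?K ^^ i) p') \<in> R" if i: "i < n" and R: "R \<in> {Cset \<beta>, C012 \<beta>, C01 \<beta>}" for i R
    proof -
      have RR: "R \<in> \<R>" using R by (simp add: \<R>_def)
      then have "R \<in> ?E2 ((?K ^^ i) p) \<longleftrightarrow> R \<in> ?E2 ((?K ^^ i) p')" using E2[OF i] by (simp only:)
      then show ?thesis
        using RR Kb_funpow_space[OF pp(1), of i] Kb_funpow_space[OF pp(2), of i] dM[OF i order_refl] by auto
    qed
    have F: "ends L ((?K ^^ n) p) = ends L ((?K ^^ n) p')" using B by simp
    have ww: "fst ((?K ^^ n) p) k = fst ((?K ^^ n) p') k" "fst (snd ((?K ^^ n) p)) k = fst (snd ((?K ^^ n) p')) k"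
      if "k < L" for k using F that by (auto simp: ends_def)
    have coords: "\<forall>k<L. fst ((?K ^^ i) p) k = fst ((?K ^^ i) p') k \<and>
        fst (snd ((?K ^^ i) p)) k = fst (snd ((?K ^^ i) p')) k" if "i \<le> n" for i
      by (rule funpow_backward[OF pp phi reg ww that]) simp_all
    show ?thesis
      unfolding word_eq_iff
    proof (intro allI impI)
      fix i assume i: "i < n"
      have "L \<le> M" by (simp add: M_def)
      have "code k ((?K ^^ i) p) = code k ((?K ^^ i) p')" if "k < L" for k
        using coords[of i] i that phi[of "k + i"] \<open>L \<le> M\<close> by (simp add: code_def phib_funpow)
      then have cc: "?c L ((?K ^^ i) p) = ?c L ((?K ^^ i) p')" by simp
      have "(?K ^^ i) p \<in> A \<longleftrightarrow> (?K ^^ i) p' \<in> A" if "A \<in> \<alpha>" for A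
      proof -
        have "A \<in> ?E1 ((?K ^^ i) p) \<longleftrightarrow> A \<in> ?E1 ((?K ^^ i) p')" using E1[OF i] by (simp only:)
        then show ?thesis using that unfolding cc by auto
      qed
      then show "?X ((?K ^^ i) p) = ?X ((?K ^^ i) p')" by blast
    qed
  qed
  \<comment> \<open>The cost of the \<open>M\<close> additional digits and of the end block; it does
    not depend on \<open>n\<close> and vanishes after division by \<open>n\<close>.\<close>
  define c0 where "c0 = fun_entropy \<mu> (word ?K ?D M) + fun_entropy \<mu> (ends L)"
  have bound: "fun_entropy \<mu> (word ?K ?X n) \<le> fun_entropy \<mu> (word ?K ?D n) + c0 + n * e" for n
  proof -
    note sD = word_add(1)[OF simple_digit, of "n + M"]
      and s1 = word_add(1)[OF G(1), of n] and s2 = word_add(1)[OF H(1), of n]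
      and sF = simple_function_invariant[OF funpow_meas simple_ends, of L n]
    note s2F = simple_function_Pair[OF s2 sF]
    note s12F = simple_function_Pair[OF s1 s2F]
    note sB = simple_function_Pair[OF sD s12F]
    have "fun_entropy \<mu> (word ?K ?X n) \<le> fun_entropy \<mu> (?B n)" by (rule fun_entropy_determined(2)[OF sB]) (rule det)
    also have "\<dots> \<le> fun_entropy \<mu> (word ?K ?D (n + M)) + (fun_entropy \<mu> (word ?K ?E1 n) + (fun_entropy \<mu> (word ?K ?E2 n) + fun_entropy \<mu> (?F n)))"
      using fun_entropy_Pair[OF sD s12F] fun_entropy_Pair[OF s1 s2F] fun_entropy_Pair[OF s2 sF] by linarith
    also have "fun_entropy \<mu> (?F n) = fun_entropy \<mu> (ends L)"
      by (rule fun_entropy_invariant[OF funpow_meas funpow_distr simple_ends])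
    also have "fun_entropy \<mu> (word ?K ?E1 n) \<le> n * (e / 2)"
      using word_add(3)[OF G(1), of n] mult_left_mono[OF G(2), of "real n"] by simp
    also have "fun_entropy \<mu> (word ?K ?E2 n) \<le> n * (e / 2)"
      using word_add(3)[OF H(1), of n] mult_left_mono[OF H(2), of "real n"] by simp
    also have "fun_entropy \<mu> (word ?K ?D (n + M)) \<le> fun_entropy \<mu> (word ?K ?D n) + fun_entropy \<mu> (word ?K ?D M)"
      by (rule word_add(2)[OF simple_digit])
    finally show ?thesis by (simp add: c0_def algebra_simps)
  qed
  have "(\<lambda>n. fun_entropy \<mu> (word ?K ?D n) / n + c0 / n + e) \<longlonglongrightarrow> entropy_rate ?D + 0 + e"
    by (intro tendsto_add entropy_rate_lim[OF simple_digit] lim_const_over_n tendsto_const)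
  moreover have "\<exists>N. \<forall>n\<ge>N. fun_entropy \<mu> (word ?K ?X n) / n \<le> fun_entropy \<mu> (word ?K ?D n) / n + c0 / n + e"
  proof (intro exI[of _ 1] allI impI)
    fix n :: nat assume "1 \<le> n"
    then have "fun_entropy \<mu> (word ?K ?X n) / n \<le> (fun_entropy \<mu> (word ?K ?D n) + c0 + n * e) / n"
      by (intro divide_right_mono bound) simp
    also have "\<dots> = fun_entropy \<mu> (word ?K ?D n) / n + c0 / n + e"
      using \<open>1 \<le> n\<close> by (simp add: add_divide_distrib)
    finally show "fun_entropy \<mu> (word ?K ?X n) / n \<le> fun_entropy \<mu> (word ?K ?D n) / n + c0 / n + e" .
  qed
  ultimately have "entropy_rate ?X \<le> entropy_rate ?D + 0 + e"
    by (rule LIMSEQ_le[OF entropy_rate_lim[OF X]])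
  then show ?thesis by simp
qed

lemma ks_entropy_le: "ks_entropy (Kb \<beta>) \<mu> \<le> ereal (entropy_rate (digit1 \<beta>))"
  unfolding ks_entropy_def
proof (rule SUP_least)
  fix \<alpha> assume "\<alpha> \<in> {\<alpha>. fin_part \<mu> \<alpha>}"
  then have \<alpha>: "fin_part \<mu> \<alpha>" by simp
  show "ereal (ent_part (Kb \<beta>) \<mu> \<alpha>) \<le> ereal (entropy_rate (digit1 \<beta>))"
    unfolding ent_part_eq_rate(2)[OF \<alpha>] ereal_less_eq
    by (rule field_le_epsilon) (rule entropy_rate_le_digit[OF \<alpha>])
qed

definition words :: "nat \<Rightarrow> nat list set" where
  "words n = {v. set v \<subseteq> {0, 1, 2} \<and> length v = n}"

lemma words_finite: "finite (words n)" and card_words: "card (words n) = 3 ^ n"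
proof -
  have "card {0, 1, 2 :: nat} = 3" by simp
  then show "finite (words n)" "card (words n) = 3 ^ n"
    unfolding words_def
    using finite_lists_length_eq[of "{0, 1, 2 :: nat}" n] card_lists_length_eq[of "{0, 1, 2 :: nat}" n]
    by (simp_all del: card_insert_disjoint)
qed

lemma digit_word_range: "word (Kb \<beta>) (digit1 \<beta>) n ` space \<mu> \<subseteq> words n"
proof (rule image_subsetI)
  fix p assume "p \<in> space \<mu>"
  then have "p \<in> space (Mb \<beta>)" by (simp add: space_mu)
  from phib_Up[OF this] have "phib \<beta> p i \<in> {0, 1, 2}" for i by simp
  then have "set (map (phib \<beta> p) [0..<n]) \<subseteq> {0, 1, 2}" unfolding set_map by (rule image_subsetI)
  then show "word (Kb \<beta>) (digit1 \<beta>) n p \<in> words n" by (simp add: digit_word_eq words_def)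
qed

lemma digit_word_le: "fun_entropy \<mu> (word (Kb \<beta>) (digit1 \<beta>) n) \<le> n * ln 3"
  using fun_entropy_le_ln_card(1)[OF word_add(1)[OF simple_digit] words_finite digit_word_range, of n]
  by (simp add: card_words ln_realpow)

lemma entropy_rate_digit_le: "entropy_rate (digit1 \<beta>) \<le> ln 3"
  using entropy_rate_le[of 1 "digit1 \<beta>"] digit_word_le[of 1] by simp

lemma digit_distr_measure:
  "measure (distr \<mu> Pups (phib \<beta>)) {b \<in> space Pups. map b [0..<n] = v}
    = measure \<mu> (word (Kb \<beta>) (digit1 \<beta>) n -` {v} \<inter> space \<mu>)"
proof -
  have m: "phib \<beta> \<in> \<mu> \<rightarrow>\<^sub>M Pups" using phib_Pups measurable_cong_sets[OF sets_mu refl] by blast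
  have "phib \<beta> -` {b \<in> space Pups. map b [0..<n] = v} \<inter> space \<mu> = word (Kb \<beta>) (digit1 \<beta>) n -` {v} \<inter> space \<mu>"
    using measurable_space[OF m] by (auto simp: digit_word_eq)
  moreover have "{b \<in> space Pups. map b [0..<n] = v} \<in> sets Pups"
    using word_sets[of 0 n v] by (simp only: funpow_0)
  ultimately show ?thesis using measure_distr[OF m] by simp
qed

text \<open>Every normalised word entropy lies between the rate and \<open>ln 3\<close>, so a rate
  of \<open>ln 3\<close> forces equality at all lengths, and the equality case of
  \<open>fun_entropy_le_ln_card\<close> makes all words equally likely.\<close>

lemma distr_phib_eq_Pups:
  assumes "entropy_rate (digit1 \<beta>) = ln 3"
  shows "distr \<mu> Pups (phib \<beta>) = Pups"
proof (rule Pups_eqI)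
  have m: "phib \<beta> \<in> \<mu> \<rightarrow>\<^sub>M Pups" using phib_Pups measurable_cong_sets[OF sets_mu refl] by blast
  show "prob_space (distr \<mu> Pups (phib \<beta>))" by (rule prob_space_distr[OF m])
  show "sets (distr \<mu> Pups (phib \<beta>)) = sets Ups_M" by (simp add: sets_Pups)
  fix v :: "nat list" assume v: "set v \<subseteq> {0, 1, 2}"
  let ?n = "length v" and ?W = "word (Kb \<beta>) (digit1 \<beta>) (length v)"
  have "?n * ln 3 \<le> fun_entropy \<mu> ?W"
  proof (cases "?n = 0")
    case False
    then have "1 \<le> ?n" by (simp add: Suc_le_eq)
    from entropy_rate_le[OF this, of "digit1 \<beta>"] False show ?thesis
      using assms by (simp add: pos_le_divide_eq mult.commute)
  qed (simp add: fun_entropy_nonneg)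
  then have eq: "fun_entropy \<mu> ?W = ln (card (words ?n))"
    using digit_word_le[of ?n] by (simp add: card_words ln_realpow)
  have "v \<in> words ?n" using v by (simp add: words_def)
  from fun_entropy_le_ln_card(2)[OF word_add(1)[OF simple_digit] words_finite digit_word_range eq this]
  show "measure (distr \<mu> Pups (phib \<beta>)) {b \<in> space (distr \<mu> Pups (phib \<beta>)). map b [0..<?n] = v} = (1 / 3) ^ ?n"
    unfolding space_distr digit_distr_measure by (simp add: card_words power_one_over)
qed

text \<open>The partition by the first digit already attains \<open>ln 3\<close>: its itinerary
  determines the digit word, which is uniform on \<open>3 ^ n\<close> words.\<close>

lemma ks_entropy_ge:
  assumes "distr \<mu> Pups (phib \<beta>) = Pups"
  shows "ereal (ln 3) \<le> ks_entropy (Kb \<beta>) \<mu>"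
proof -
  let ?D = "digit1 \<beta>" and ?K = "Kb \<beta>"
  define \<alpha> where "\<alpha> = (\<lambda>i. ?D -` {i} \<inter> space \<mu>) ` {0, 1, 2}"
  have mD: "?D \<in> \<mu> \<rightarrow>\<^sub>M count_space UNIV" using digit1_measurable measurable_cong_sets[OF sets_mu refl] by blast
  have "\<Union>\<alpha> = space \<mu>" using digit1_range by (fastforce simp: \<alpha>_def space_mu)
  moreover have "\<alpha> \<subseteq> sets \<mu>" unfolding \<alpha>_def using measurable_sets[OF mD] by auto
  moreover have "disjoint \<alpha>" by (auto simp: \<alpha>_def disjoint_def)
  ultimately have \<alpha>: "fin_part \<mu> \<alpha>" by (simp add: fin_part_def) (simp add: \<alpha>_def)
  let ?X = "\<lambda>p. {A \<in> \<alpha>. p \<in> A}"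
  have sX: "simple_function \<mu> ?X" by (rule ent_part_eq_rate(1)[OF \<alpha>])
  have DX: "?D p = ?D p'" if "?X p = ?X p'" "p \<in> space \<mu>" for p p'
  proof -
    have "?D -` {?D p} \<inter> space \<mu> \<in> ?X p"
      using that(2) digit1_range[of p] by (auto simp: \<alpha>_def space_mu)
    then have "?D -` {?D p} \<inter> space \<mu> \<in> ?X p'" unfolding that(1) .
    then show ?thesis by simp
  qed
  have le: "fun_entropy \<mu> (word ?K ?D n) \<le> fun_entropy \<mu> (word ?K ?X n)" for n
  proof (rule fun_entropy_determined(2)[OF word_add(1)[OF sX]])
    fix p p' assume p: "p \<in> space \<mu>" and eq: "word ?K ?X n p = word ?K ?X n p'"
    show "word ?K ?D n p = word ?K ?D n p'"
      using eq DX funpow_space[OF p] unfolding word_eq_iff by blast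
  qed
  have ent: "fun_entropy \<mu> (word ?K ?D n) = n * ln 3" for n
  proof -
    have "prob (word ?K ?D n -` {v} \<inter> space \<mu>) = (1 / 3) ^ n" if "v \<in> words n" for v
      using measure_Pups_word[of v] that digit_distr_measure[of n v] unfolding assms by (simp add: words_def)
    then have "fun_entropy \<mu> (word ?K ?D n) = (\<Sum>v\<in>words n. - ((1 / 3) ^ n) * ln ((1 / 3) ^ n))"
      unfolding fun_entropy_superset[OF words_finite digit_word_range] by (intro sum.cong) simp_all
    also have "\<dots> = n * ln 3"
      by (simp add: card_words ln_realpow ln_div power_one_over)
    finally show ?thesis .
  qed
  have "ln 3 \<le> entropy_rate ?X"
  proof (rule LIMSEQ_le_const[OF entropy_rate_lim[OF sX]], intro exI[of _ 1] allI impI)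
    fix n :: nat assume "1 \<le> n"
    then show "ln 3 \<le> fun_entropy \<mu> (word ?K ?X n) / n"
      using le[of n] ent[of n] by (simp add: pos_le_divide_eq mult.commute)
  qed
  then have "ereal (ln 3) \<le> ereal (ent_part ?K \<mu> \<alpha>)" unfolding ent_part_eq_rate(2)[OF \<alpha>] by simp
  also have "\<dots> \<le> ks_entropy ?K \<mu>" unfolding ks_entropy_def by (rule SUP_upper) (use \<alpha> in simp)
  finally show ?thesis .
qed

end

text \<open>The equation \<open>x ^ 2 * (x - 1) = 1\<close> forces \<open>x > 1\<close>, where the
  left side is strictly increasing, so the root is unique. The cubic takes the values
  \<open>-1\<close> at 1 and \<open>1/8\<close> at \<open>3/2\<close>.\<close>

lemma beta_star_lt: "beta_star < 3 / 2"
proof -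
  let ?f = "\<lambda>x::real. x ^ 3 - x ^ 2 - 1"
  have pos: "1 < x" if "?f x = 0" for x
  proof (rule ccontr)
    assume "\<not> 1 < x"
    then have "x ^ 2 * (x - 1) \<le> 0" by (intro mult_nonneg_nonpos) auto
    then show False using that by (simp add: power3_eq_cube power2_eq_square algebra_simps)
  qed
  have less: "?f x < ?f y" if "1 < x" "x < y" for x y
  proof -
    have "x ^ 2 * (x - 1) < y ^ 2 * (y - 1)"
      using that by (intro mult_strict_mono power_strict_mono) auto
    then show ?thesis by (simp add: power3_eq_cube power2_eq_square algebra_simps)
  qed
  have "\<exists>x\<ge>1. x \<le> 3 / 2 \<and> ?f x = 0"
    by (rule IVT) (auto simp: power3_eq_cube power2_eq_square intro!: continuous_intros)
  then obtain x where x: "?f x = 0" "x \<le> 3 / 2" by auto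
  have "beta_star = x"
    unfolding beta_star_def
  proof (rule the_equality)
    show "?f x = 0" by (rule x(1))
    fix y assume "?f y = 0"
    then show "y = x" using less[of x y] less[of y x] pos[of x] pos[of y] x(1) by fastforce
  qed
  moreover have "x \<noteq> 3 / 2"
  proof
    assume "x = 3 / 2"
    then show False using x(1) by (simp only: power3_eq_cube power2_eq_square)
  qed
  ultimately show ?thesis using x by simp
qed

text \<open>\<open>nub\<close> is introduced by \<open>measure_of\<close>, which falls back to the
  zero measure if the given set function is not a measure. The first conjunct therefore records that
  the images are measurable and that the defining formula really holds.\<close>

theorem theorem4p10:
  fixes \<beta> :: real
  assumes "1 < \<beta>" and "\<beta> < beta_star"
  shows "(\<forall>A\<in>sets (Mb \<beta>). phib \<beta> ` (Zb \<beta> \<inter> A) \<in> sets Pups \<and>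
            emeasure (nub \<beta>) A = emeasure Pups (phib \<beta> ` (Zb \<beta> \<inter> A)))
       \<and> invariant_prob (Mb \<beta>) (Kb \<beta>) (nub \<beta>)
       \<and> (\<forall>\<mu>. invariant_prob (Mb \<beta>) (Kb \<beta>) \<mu> \<longrightarrow>
              ks_entropy (Kb \<beta>) \<mu> \<le> ks_entropy (Kb \<beta>) (nub \<beta>))
       \<and> (\<forall>\<mu>. invariant_prob (Mb \<beta>) (Kb \<beta>) \<mu> \<and>
              ks_entropy (Kb \<beta>) \<mu> = ks_entropy (Kb \<beta>) (nub \<beta>) \<longrightarrow> \<mu> = nub \<beta>)"
proof -
  interpret random_beta \<beta>
    using assms beta_star_lt by unfold_locales simp_all
  interpret nu: invariant_random_beta \<beta> "nub \<beta>"
    by unfold_locales (rule invariant_nub)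
  have nu: "ereal (ln 3) \<le> ks_entropy (Kb \<beta>) (nub \<beta>)" by (rule nu.ks_entropy_ge[OF distr_nub])
  have max: "ks_entropy (Kb \<beta>) \<mu> \<le> ks_entropy (Kb \<beta>) (nub \<beta>)"
    and uniq: "ks_entropy (Kb \<beta>) \<mu> = ks_entropy (Kb \<beta>) (nub \<beta>) \<Longrightarrow> \<mu> = nub \<beta>"
    if "invariant_prob (Mb \<beta>) (Kb \<beta>) \<mu>" for \<mu>
  proof -
    interpret mu: invariant_random_beta \<beta> \<mu> by unfold_locales (rule that)
    have "ereal (mu.entropy_rate (digit1 \<beta>)) \<le> ereal (ln 3)" using mu.entropy_rate_digit_le by simp
    then show "ks_entropy (Kb \<beta>) \<mu> \<le> ks_entropy (Kb \<beta>) (nub \<beta>)"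
      using mu.ks_entropy_le nu by (metis order_trans)
    \<comment> \<open>Now \<open>ln 3\<close> is at most the entropy of \<open>nub\<close>, which
      equals that of \<open>\<mu>\<close>, which is at most the digit rate, which is at most
      \<open>ln 3\<close>; so the rate is exactly \<open>ln 3\<close>.\<close>
    assume "ks_entropy (Kb \<beta>) \<mu> = ks_entropy (Kb \<beta>) (nub \<beta>)"
    then have "ereal (ln 3) \<le> ereal (mu.entropy_rate (digit1 \<beta>))"
      using nu mu.ks_entropy_le by (metis order_trans)
    then have "mu.entropy_rate (digit1 \<beta>) = ln 3" using mu.entropy_rate_digit_le by simp
    then show "\<mu> = nub \<beta>" by (intro nub_unique mu.sets_mu mu.distr_phib_eq_Pups)
  qed
  show ?thesis using phib_image_sets emeasure_nub invariant_nub max uniq by blast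
qed

end
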